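(* Let $\hat{\mathfrak{g}}[\sigma]$ be a twisted affine Lie algebra and let $\pi:\hat{\mathfrak{g}}[\sigma]\to\mathrm{End}\,W$ be an integrable representation in the category $\mathcal{C}$. Define linear maps $\pi_{\mathcal{R}}$ and $\pi_{\mathcal{E}}$ from $\hat{\mathfrak{g}}[\sigma]$ to $\mathrm{End}\,W$ in terms of generating functions by $$\pi_{\mathcal{R}}(a(x)+\alpha\mathbf{k})=\psi_{\mathcal{R}}(\pi(a(x)))+\alpha\pi(\mathbf{k}),\qquad \pi_{\mathcal{E}}(a(x)+\beta\mathbf{k})=\psi_{\mathcal{E}}(\pi(a(x)))$$ for $a\in\mathfrak{g}$, $\alpha,\beta\in\mathbb{C}$, where $\pi$ (and likewise $\pi_{\mathcal{R}},\pi_{\mathcal{E}}$) is extended coefficientwise to formal series in $x^{\pm 1/N}$ with coefficients in $\hat{\mathfrak{g}}[\sigma]$. Then $\pi=\pi_{\mathcal{R}}+\pi_{\mathcal{E}}$, and the linear map $$\hat{\mathfrak{g}}[\sigma]\oplus\hat{\mathfrak{g}}[\sigma]\to\mathrm{End}\,W,\qquad (u,v)\mapsto\pi_{\mathcal{R}}(u)+\pi_{\mathcal{E}}(v)$$ defines a representation of $\hat{\mathfrak{g}}[\sigma]\oplus\hat{\mathfrak{g}}[\sigma]$ on $W$. If $(W,\pi)$ is irreducible, then $W$ is an irreducible $\hat{\mathfrak{g}}[\sigma]\oplus\hat{\mathfrak{g}}[\sigma]$-module. Furthermore, $(W,\pi_{\mathcal{R}})$ is a restricted integrable $\hat{\mathfrak{g}}[\sigma]$-module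 (in the category $\mathcal{R}$) and $(W,\pi_{\mathcal{E}})$ is an integrable $\hat{\mathfrak{g}}[\sigma]$-module in the category $\mathcal{E}$.
   Context: Let $\mathfrak{g}$ be a finite-dimensional simple Lie algebra over $\mathbb{C}$ with the nondegenerate symmetric invariant bilinear form $\langle\cdot,\cdot\rangle$ normalized so that the squared length of the longest roots is $2$. Let $\sigma$ be an automorphism of $\mathfrak{g}$ of order $N$, $\varepsilon=\exp(2\pi \sqrt{-1}/N)$, and $\mathfrak{g}_i=\{a\in\mathfrak{g}\mid \sigma(a)=\varepsilon^i a\}$ for $0\le i\le N-1$, so $\mathfrak{g}=\bigoplus_{i=0}^{N-1}\mathfrak{g}_i$. The twisted affine Lie algebra is $\hat{\mathfrak{g}}[\sigma]=\bigoplus_{i=0}^{N-1}\mathfrak{g}_i\otimes t^{i/N}\mathbb{C}[t,t^{-1}]\oplus\mathbb{C}\mathbf{k}$ with $\mathbf{k}$ a nonzero central element and $[a\otimes t^{m+i/N},b\otimes t^{n+j/N}]=[a,b]\otimes t^{m+n+(i+j)/N}+(m+\tfrac{i}{N})\langle a,b\rangle\delta_{m+i/N,\,-n-j/N}\mathbf{k}$ for $a\in\mathfrak{g}_i$, $b\in\mathfrak{g}_j$, $m,n\in\mathbb{Z}$. For $a\in\mathfrak{g}_i$ put $a(x)=\sum_{n\in\mathbb{Z}}(a\otimes t^{n+i/N})x^{-n-i/N-1}$, extended linearly to all $a\in\mathfrak{g}$. On a module, for $a\in\mathfrak{g}_i$, $a(n)$ denotes the operator by which $a\otimes t^{n+i/N}$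 acts. Integrable: fix a Cartan subalgebra $\mathfrak{h}_0$ of the reductive Lie algebra $\mathfrak{g}_0$; a module $W$ is integrable if for every $i$, every nonzero weight $\alpha\in\mathfrak{h}_0^*$, every $a\in\mathfrak{g}_i$ with $[h,a]=\alpha(h)a$ for all $h\in\mathfrak{h}_0$, and every $n\in\mathbb{Z}$, the operator $a(n)$ acts locally nilpotently on $W$ (i.e. real root vectors act locally nilpotently). For a vector space $W$, $W((x^{1/N}))$ is the space of lower truncated formal Laurent series in $x^{1/N}$ with coefficients in $W$, and $\mathcal{E}(W)=\mathrm{Hom}(W,W((x^{1/N})))$ is identified with the set of doubly infinite series $A(x)\in(\mathrm{End}\,W)[[x^{1/N},x^{-1/N}]]$ with $A(x)w\in W((x^{1/N}))$ for all $w\in W$. Categories: a $\hat{\mathfrak{g}}[\sigma]$-module $W$ is in $\mathcal{R}$ (restricted) if $a(x)\in\mathrm{Hom}(W,W((x^{1/N})))$ for all $a\in\mathfrak{g}$; in $\mathcal{E}$ if there is a nonzero $p(x)\in\mathbb{C}[x]$ (depending on $W$) with $p(x)a(x)=0$ on $W$ for all $a\in\mathfrak{g}$; in $\mathcal{C}$ if there is a nonzero $p(x)\in\mathbb{C}[x]$ (depending on $W$) with $p(x)a(x)\in\mathrm{Hom}(W,W((x^{1/N})))$ for all $a\in\mathfrak{g}$. Let $\bar{\mathcal{E}}(W)$ be the space of $a(x)\in(\mathrm{End}\,W)[[x^{1/N},x^{-1/N}]]$ such that $p(x)a(x)\in\mathcal{E}(W)$ for some nonzero polynomial $p(x)$.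 Let $\iota_{x;0}:\mathbb{C}(x)\to\mathbb{C}((x))$ be the Laurent expansion at $0$. The linear map $\psi_{\mathcal{R}}:\bar{\mathcal{E}}(W)\to\mathcal{E}(W)$ is given by $\psi_{\mathcal{R}}(a(x))w=\iota_{x;0}(f(x)^{-1})(f(x)a(x)w)$ for $w\in W$, where $f(x)$ is any nonzero polynomial with $f(x)a(x)\in\mathcal{E}(W)$ (this is independent of $f$). Put $\psi_{\mathcal{E}}(a(x))=a(x)-\psi_{\mathcal{R}}(a(x))$. *)

theory Defs
  imports
    Complex_Main
    "HOL-Library.Product_Plus"
    "HOL-Library.Poly_Mapping"
    "HOL-Computational_Algebra.Computational_Algebra"
begin

section \<open>Lie algebras over the complex numbers\<close>

locale lie_algebra = vector_space sG
  for sG :: "complex \<Rightarrow> 'g::ab_group_add \<Rightarrow> 'g" +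
  fixes bracket :: "'g \<Rightarrow> 'g \<Rightarrow> 'g"
  assumes bracket_linear_left: "Vector_Spaces.linear sG sG (\<lambda>x. bracket x y)"
    and bracket_linear_right: "Vector_Spaces.linear sG sG (\<lambda>y. bracket x y)"
    and bracket_self: "bracket x x = 0"
    and jacobi: "bracket x (bracket y z) + bracket y (bracket z x) + bracket z (bracket x y) = 0"

definition lie_ideal :: "(complex \<Rightarrow> 'g \<Rightarrow> 'g) \<Rightarrow> ('g \<Rightarrow> 'g \<Rightarrow> 'g) \<Rightarrow> 'g::ab_group_add set \<Rightarrow> bool" where
  "lie_ideal sG bracket I \<longleftrightarrow>
     module.subspace sG I \<and> (\<forall>x. \<forall>y\<in>I. bracket x y \<in> I)"

definition lie_subalgebra :: "(complex \<Rightarrow> 'g \<Rightarrow> 'g) \<Rightarrow> ('g \<Rightarrow> 'g \<Rightarrow> 'g) \<Rightarrow> 'g::ab_group_add set \<Rightarrow> bool" where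
  "lie_subalgebra sG bracket L \<longleftrightarrow>
     module.subspace sG L \<and> (\<forall>x\<in>L. \<forall>y\<in>L. bracket x y \<in> L)"

locale simple_lie_algebra = lie_algebra +
  assumes finite_dimensional: "\<exists>B. finite B \<and> span B = UNIV"
    and not_abelian: "\<exists>x y. bracket x y \<noteq> 0"
    and ideals_trivial: "lie_ideal sG bracket I \<Longrightarrow> I = {0} \<or> I = UNIV"

primrec lower_central_series ::
    "(complex \<Rightarrow> 'g \<Rightarrow> 'g) \<Rightarrow> ('g \<Rightarrow> 'g \<Rightarrow> 'g) \<Rightarrow> 'g::ab_group_add set \<Rightarrow> nat \<Rightarrow> 'g set" where
  "lower_central_series sG bracket L 0 = L"
| "lower_central_series sG bracket L (Suc n) =
     module.span sG {bracket x y | x y. x \<in> L \<and> y \<in> lower_central_series sG bracket L n}"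

text \<open>A Cartan subalgebra \<open>H\<close> of a subalgebra \<open>L\<close>: nilpotent and self-normalizing in \<open>L\<close>.\<close>

definition cartan_subalgebra ::
    "(complex \<Rightarrow> 'g \<Rightarrow> 'g) \<Rightarrow> ('g \<Rightarrow> 'g \<Rightarrow> 'g) \<Rightarrow> 'g::ab_group_add set \<Rightarrow> 'g set \<Rightarrow> bool" where
  "cartan_subalgebra sG bracket L H \<longleftrightarrow>
     lie_subalgebra sG bracket H \<and> H \<subseteq> L \<and>
     (\<exists>n. lower_central_series sG bracket H n = {0}) \<and>
     {x \<in> L. \<forall>h\<in>H. bracket x h \<in> H} = H"

text \<open>Elements of the dual of \<open>H\<close> are represented by functions on the ambient type that are
  linear on \<open>H\<close>; their values outside \<open>H\<close> are irrelevant.\<close>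

definition functional_on :: "(complex \<Rightarrow> 'g \<Rightarrow> 'g) \<Rightarrow> 'g::ab_group_add set \<Rightarrow> ('g \<Rightarrow> complex) \<Rightarrow> bool" where
  "functional_on sG H \<alpha> \<longleftrightarrow>
     (\<forall>x\<in>H. \<forall>y\<in>H. \<alpha> (x + y) = \<alpha> x + \<alpha> y) \<and> (\<forall>c. \<forall>x\<in>H. \<alpha> (sG c x) = c * \<alpha> x)"

definition weight_space ::
    "(complex \<Rightarrow> 'g \<Rightarrow> 'g) \<Rightarrow> ('g \<Rightarrow> 'g \<Rightarrow> 'g) \<Rightarrow> 'g::ab_group_add set \<Rightarrow> ('g \<Rightarrow> complex) \<Rightarrow> 'g set" where
  "weight_space sG bracket H \<alpha> = {a. \<forall>h\<in>H. bracket h a = sG (\<alpha> h) a}"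

definition lie_root ::
    "(complex \<Rightarrow> 'g \<Rightarrow> 'g) \<Rightarrow> ('g \<Rightarrow> 'g \<Rightarrow> 'g) \<Rightarrow> 'g::ab_group_add set \<Rightarrow> ('g \<Rightarrow> complex) \<Rightarrow> bool" where
  "lie_root sG bracket H \<alpha> \<longleftrightarrow>
     functional_on sG H \<alpha> \<and> (\<exists>h\<in>H. \<alpha> h \<noteq> 0) \<and> weight_space sG bracket H \<alpha> \<noteq> {0}"

text \<open>The squared length of \<open>\<alpha>\<close> for the form carried over from \<open>H\<close> to its dual, that is
  \<open>\<langle>t, t\<rangle>\<close> where \<open>t\<close> is the element of \<open>H\<close> representing \<open>\<alpha>\<close>.\<close>

definition squared_length :: "('g \<Rightarrow> 'g \<Rightarrow> complex) \<Rightarrow> 'g set \<Rightarrow> ('g \<Rightarrow> complex) \<Rightarrow> complex" where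
  "squared_length form H \<alpha> = (let t = (THE t. t \<in> H \<and> (\<forall>h\<in>H. form t h = \<alpha> h)) in form t t)"

text \<open>All Cartan subalgebras of a finite-dimensional complex Lie algebra are conjugate, so it
  does not matter which one is used in the normalization.\<close>

definition long_roots_normalized ::
    "(complex \<Rightarrow> 'g \<Rightarrow> 'g) \<Rightarrow> ('g \<Rightarrow> 'g \<Rightarrow> 'g) \<Rightarrow> ('g::ab_group_add \<Rightarrow> 'g \<Rightarrow> complex) \<Rightarrow> bool" where
  "long_roots_normalized sG bracket form \<longleftrightarrow>
     (\<exists>H. cartan_subalgebra sG bracket UNIV H \<and>
       (\<exists>\<alpha>. lie_root sG bracket H \<alpha> \<and> squared_length form H \<alpha> = 2) \<and>
       (\<forall>\<alpha>. lie_root sG bracket H \<alpha> \<longrightarrow>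
          (\<exists>r::real. squared_length form H \<alpha> = of_real r \<and> r \<le> 2)))"


section \<open>Representations\<close>

text \<open>A Lie algebra is here a carrier set \<open>L\<close> inside a type, with scalar multiplication \<open>sL\<close> and
  bracket \<open>br\<close>.  The module is the whole type \<open>'w\<close> with scalar multiplication \<open>sW\<close>.\<close>

definition linear_to_End ::
    "'l set \<Rightarrow> (complex \<Rightarrow> 'l \<Rightarrow> 'l) \<Rightarrow> (complex \<Rightarrow> 'w \<Rightarrow> 'w) \<Rightarrow>
     ('l::ab_group_add \<Rightarrow> 'w::ab_group_add \<Rightarrow> 'w) \<Rightarrow> bool" where
  "linear_to_End L sL sW \<rho> \<longleftrightarrow>
     (\<forall>x\<in>L. Vector_Spaces.linear sW sW (\<rho> x)) \<and>
     (\<forall>x\<in>L. \<forall>y\<in>L. \<forall>w. \<rho> (x + y) w = \<rho> x w + \<rho> y w) \<and>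
     (\<forall>c. \<forall>x\<in>L. \<forall>w. \<rho> (sL c x) w = sW c (\<rho> x w))"

definition lie_rep ::
    "'l set \<Rightarrow> (complex \<Rightarrow> 'l \<Rightarrow> 'l) \<Rightarrow> ('l \<Rightarrow> 'l \<Rightarrow> 'l) \<Rightarrow> (complex \<Rightarrow> 'w \<Rightarrow> 'w) \<Rightarrow>
     ('l::ab_group_add \<Rightarrow> 'w::ab_group_add \<Rightarrow> 'w) \<Rightarrow> bool" where
  "lie_rep L sL br sW \<rho> \<longleftrightarrow>
     linear_to_End L sL sW \<rho> \<and>
     (\<forall>x\<in>L. \<forall>y\<in>L. \<forall>w. \<rho> (br x y) w = \<rho> x (\<rho> y w) - \<rho> y (\<rho> x w))"

definition irreducible_rep ::
    "'l set \<Rightarrow> (complex \<Rightarrow> 'w \<Rightarrow> 'w) \<Rightarrow> ('l \<Rightarrow> 'w::ab_group_add \<Rightarrow> 'w) \<Rightarrow> bool" where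
  "irreducible_rep L sW \<rho> \<longleftrightarrow>
     (\<exists>w::'w. w \<noteq> 0) \<and>
     (\<forall>U. module.subspace sW U \<and> (\<forall>x\<in>L. \<forall>u\<in>U. \<rho> x u \<in> U) \<longrightarrow> U = {0} \<or> U = UNIV)"

definition dsum_scale :: "(complex \<Rightarrow> 'l \<Rightarrow> 'l) \<Rightarrow> complex \<Rightarrow> 'l \<times> 'l \<Rightarrow> 'l \<times> 'l" where
  "dsum_scale sL c = (\<lambda>(u, v). (sL c u, sL c v))"

definition dsum_bracket :: "('l \<Rightarrow> 'l \<Rightarrow> 'l) \<Rightarrow> 'l \<times> 'l \<Rightarrow> 'l \<times> 'l \<Rightarrow> 'l \<times> 'l" where
  "dsum_bracket br = (\<lambda>(u, v) (u', v'). (br u u', br v v'))"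


section \<open>The twisted affine Lie algebra\<close>

definition root_of_unity :: "nat \<Rightarrow> complex" where
  "root_of_unity N = exp (2 * of_real pi * \<i> / of_nat N)"

text \<open>The eigenspace \<open>\<gg>\<^sub>i\<close>, indexed by all integers; it depends only on \<open>i\<close> modulo \<open>N\<close>.\<close>

definition grade ::
    "(complex \<Rightarrow> 'g \<Rightarrow> 'g) \<Rightarrow> ('g \<Rightarrow> 'g) \<Rightarrow> nat \<Rightarrow> int \<Rightarrow> 'g set" where
  "grade sG \<sigma> N i = {a. \<sigma> a = sG (root_of_unity N powi i) a}"

locale twisted_affine_data = simple_lie_algebra sG bracket
  for sG :: "complex \<Rightarrow> 'g::ab_group_add \<Rightarrow> 'g" and bracket :: "'g \<Rightarrow> 'g \<Rightarrow> 'g" +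
  fixes form :: "'g \<Rightarrow> 'g \<Rightarrow> complex"
    and \<sigma> :: "'g \<Rightarrow> 'g"
    and N :: nat
  assumes form_linear_left: "Vector_Spaces.linear sG (*) (\<lambda>x. form x y)"
    and form_linear_right: "Vector_Spaces.linear sG (*) (\<lambda>y. form x y)"
    and form_sym: "form x y = form y x"
    and form_invariant: "form (bracket x y) z = form x (bracket y z)"
    and form_nondegenerate: "(\<And>y. form x y = 0) \<Longrightarrow> x = 0"
    and form_normalized: "long_roots_normalized sG bracket form"
    and \<sigma>_linear: "Vector_Spaces.linear sG sG \<sigma>"
    and \<sigma>_bij: "bij \<sigma>"
    and \<sigma>_bracket: "\<sigma> (bracket x y) = bracket (\<sigma> x) (\<sigma> y)"
    and N_pos: "N > 0"
    and \<sigma>_pow_N: "\<sigma> ^^ N = id"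
    and \<sigma>_order: "0 < k \<Longrightarrow> k < N \<Longrightarrow> \<sigma> ^^ k \<noteq> id"

text \<open>The pair \<open>(f, c)\<close> stands for \<open>\<Sum>n. f n \<otimes> t\<^bsup>n/N\<^esup> + c \<^bold>k\<close>: exponents of \<open>t\<close> are recorded by
  their numerators over \<open>N\<close>.  The exponent \<open>m + i/N\<close> corresponds to the index \<open>m N + i\<close>.\<close>

type_synonym 'g affine = "(int \<Rightarrow>\<^sub>0 'g) \<times> complex"

definition affine_carrier ::
    "(complex \<Rightarrow> 'g \<Rightarrow> 'g) \<Rightarrow> ('g \<Rightarrow> 'g) \<Rightarrow> nat \<Rightarrow> 'g::ab_group_add affine set" where
  "affine_carrier sG \<sigma> N = {(f, c). \<forall>n. Poly_Mapping.lookup f n \<in> grade sG \<sigma> N n}"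

definition affine_scale ::
    "(complex \<Rightarrow> 'g \<Rightarrow> 'g) \<Rightarrow> complex \<Rightarrow> 'g::ab_group_add affine \<Rightarrow> 'g affine" where
  "affine_scale sG c = (\<lambda>(f, d). (Poly_Mapping.map (sG c) f, c * d))"

definition affine_bracket ::
    "('g \<Rightarrow> 'g \<Rightarrow> 'g) \<Rightarrow> ('g \<Rightarrow> 'g \<Rightarrow> complex) \<Rightarrow> nat \<Rightarrow>
     'g::ab_group_add affine \<Rightarrow> 'g affine \<Rightarrow> 'g affine" where
  "affine_bracket bracket form N = (\<lambda>(f, c) (g, d).
     (\<Sum>m\<in>Poly_Mapping.keys f. \<Sum>n\<in>Poly_Mapping.keys g.
        Poly_Mapping.single (m + n) (bracket (Poly_Mapping.lookup f m) (Poly_Mapping.lookup g n)),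
      \<Sum>m\<in>Poly_Mapping.keys f. \<Sum>n\<in>Poly_Mapping.keys g.
        if m = - n
        then of_int m / of_nat N * form (Poly_Mapping.lookup f m) (Poly_Mapping.lookup g n)
        else 0))"

definition monomial :: "'g::ab_group_add \<Rightarrow> int \<Rightarrow> 'g affine" where
  "monomial a n = (Poly_Mapping.single n a, 0)"

definition central :: "'g::ab_group_add affine" where
  "central = (0, 1)"

text \<open>\<open>graded_part sG \<sigma> N a i\<close> is the component of \<open>a\<close> in \<open>\<gg>\<^sub>i\<close> for the decomposition
  \<open>\<gg> = \<Oplus>\<^bsub>0 \<le> i < N\<^esub> \<gg>\<^sub>i\<close>.\<close>

definition graded_part ::
    "(complex \<Rightarrow> 'g \<Rightarrow> 'g) \<Rightarrow> ('g \<Rightarrow> 'g) \<Rightarrow> nat \<Rightarrow> 'g::ab_group_add \<Rightarrow> int \<Rightarrow> 'g" where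
  "graded_part sG \<sigma> N a =
     (THE d. (\<forall>i\<in>{0..<int N}. d i \<in> grade sG \<sigma> N i) \<and> (\<forall>i. i \<notin> {0..<int N} \<longrightarrow> d i = 0) \<and>
             (\<Sum>i\<in>{0..<int N}. d i) = a)"


section \<open>Formal series in \<open>x\<^bsup>1/N\<^esup>\<close>\<close>

text \<open>A doubly infinite series in \<open>x\<^bsup>1/N\<^esup>\<close> is a function on the integers whose value at \<open>k\<close> is the
  coefficient of \<open>x\<^bsup>k/N\<^esup>\<close>.  For homogeneous \<open>a\<close> in \<open>\<gg>\<^sub>i\<close> the series \<open>a(x)\<close> has the coefficient
  \<open>a \<otimes> t\<^bsup>n + i/N\<^esup>\<close> at \<open>x\<^bsup>- n - i/N - 1\<^esup>\<close>, that is, \<open>a \<otimes> t\<^bsup>(-k-N)/N\<^esup>\<close> at \<open>x\<^bsup>k/N\<^esup>\<close> for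
  \<open>- k - N \<equiv> i\<close> modulo \<open>N\<close>, and \<open>0\<close> at the other \<open>x\<^bsup>k/N\<^esup>\<close>; this is extended linearly.\<close>

definition gen_series ::
    "(complex \<Rightarrow> 'g \<Rightarrow> 'g) \<Rightarrow> ('g \<Rightarrow> 'g) \<Rightarrow> nat \<Rightarrow> 'g::ab_group_add \<Rightarrow> int \<Rightarrow> 'g affine" where
  "gen_series sG \<sigma> N a k =
     monomial (graded_part sG \<sigma> N a ((- k - int N) mod int N)) (- k - int N)"

definition const_series :: "'a::zero \<Rightarrow> int \<Rightarrow> 'a" where
  "const_series c k = (if k = 0 then c else 0)"

definition poly_mult_series ::
    "nat \<Rightarrow> (complex \<Rightarrow> 'w \<Rightarrow> 'w) \<Rightarrow> complex poly \<Rightarrow>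
     (int \<Rightarrow> 'w::ab_group_add \<Rightarrow> 'w) \<Rightarrow> int \<Rightarrow> 'w \<Rightarrow> 'w" where
  "poly_mult_series N sW p A k w = (\<Sum>j\<le>degree p. sW (coeff p j) (A (k - int N * int j) w))"

definition calE :: "(complex \<Rightarrow> 'w \<Rightarrow> 'w) \<Rightarrow> (int \<Rightarrow> 'w::ab_group_add \<Rightarrow> 'w) set" where
  "calE sW = {A. (\<forall>k. Vector_Spaces.linear sW sW (A k)) \<and> (\<forall>w. \<exists>K. \<forall>k<K. A k w = 0)}"

text \<open>The product of \<open>l \<in> \<complex>((x))\<close> and \<open>v \<in> W((x\<^bsup>1/N\<^esup>))\<close>; each coefficient is a finite sum.\<close>

definition fls_mult_series ::
    "nat \<Rightarrow> (complex \<Rightarrow> 'w \<Rightarrow> 'w) \<Rightarrow> complex fls \<Rightarrow> (int \<Rightarrow> 'w::ab_group_add) \<Rightarrow> int \<Rightarrow> 'w" where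
  "fls_mult_series N sW l v k = Sum_any (\<lambda>j. sW (fls_nth l j) (v (k - int N * j)))"

text \<open>The expansion at \<open>0\<close> of \<open>1/f\<close> is the inverse of \<open>f\<close> in the field of Laurent series.\<close>

definition psi_R ::
    "nat \<Rightarrow> (complex \<Rightarrow> 'w \<Rightarrow> 'w) \<Rightarrow> (int \<Rightarrow> 'w::ab_group_add \<Rightarrow> 'w) \<Rightarrow> int \<Rightarrow> 'w \<Rightarrow> 'w" where
  "psi_R N sW A k w =
     (let f = (SOME f. f \<noteq> 0 \<and> poly_mult_series N sW f A \<in> calE sW)
      in fls_mult_series N sW (inverse (fps_to_fls (fps_of_poly f)))
           (\<lambda>m. poly_mult_series N sW f A m w) k)"

definition psi_E ::
    "nat \<Rightarrow> (complex \<Rightarrow> 'w \<Rightarrow> 'w) \<Rightarrow> (int \<Rightarrow> 'w::ab_group_add \<Rightarrow> 'w) \<Rightarrow> int \<Rightarrow> 'w \<Rightarrow> 'w" where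
  "psi_E N sW A k w = A k w - psi_R N sW A k w"


section \<open>Integrable modules and the three categories\<close>

definition integrable_rep ::
    "(complex \<Rightarrow> 'g \<Rightarrow> 'g) \<Rightarrow> ('g \<Rightarrow> 'g \<Rightarrow> 'g) \<Rightarrow> ('g \<Rightarrow> 'g) \<Rightarrow> nat \<Rightarrow> 'g::ab_group_add set \<Rightarrow>
     ('g affine \<Rightarrow> 'w::ab_group_add \<Rightarrow> 'w) \<Rightarrow> bool" where
  "integrable_rep sG bracket \<sigma> N H0 \<rho> \<longleftrightarrow>
     (\<forall>i\<in>{0..<int N}. \<forall>\<alpha>. functional_on sG H0 \<alpha> \<and> (\<exists>h\<in>H0. \<alpha> h \<noteq> 0) \<longrightarrow>
       (\<forall>a \<in> grade sG \<sigma> N i \<inter> weight_space sG bracket H0 \<alpha>. \<forall>n::int. \<forall>w.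
          \<exists>m. (\<rho> (monomial a (n * int N + i)) ^^ m) w = 0))"

definition category_R ::
    "(complex \<Rightarrow> 'g \<Rightarrow> 'g) \<Rightarrow> ('g \<Rightarrow> 'g) \<Rightarrow> nat \<Rightarrow> (complex \<Rightarrow> 'w \<Rightarrow> 'w) \<Rightarrow>
     ('g::ab_group_add affine \<Rightarrow> 'w::ab_group_add \<Rightarrow> 'w) \<Rightarrow> bool" where
  "category_R sG \<sigma> N sW \<rho> \<longleftrightarrow> (\<forall>a. (\<lambda>k. \<rho> (gen_series sG \<sigma> N a k)) \<in> calE sW)"

definition category_E ::
    "(complex \<Rightarrow> 'g \<Rightarrow> 'g) \<Rightarrow> ('g \<Rightarrow> 'g) \<Rightarrow> nat \<Rightarrow> (complex \<Rightarrow> 'w \<Rightarrow> 'w) \<Rightarrow>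
     ('g::ab_group_add affine \<Rightarrow> 'w::ab_group_add \<Rightarrow> 'w) \<Rightarrow> bool" where
  "category_E sG \<sigma> N sW \<rho> \<longleftrightarrow>
     (\<exists>p. p \<noteq> 0 \<and>
       (\<forall>a k w. poly_mult_series N sW p (\<lambda>k. \<rho> (gen_series sG \<sigma> N a k)) k w = 0))"

definition category_C ::
    "(complex \<Rightarrow> 'g \<Rightarrow> 'g) \<Rightarrow> ('g \<Rightarrow> 'g) \<Rightarrow> nat \<Rightarrow> (complex \<Rightarrow> 'w \<Rightarrow> 'w) \<Rightarrow>
     ('g::ab_group_add affine \<Rightarrow> 'w::ab_group_add \<Rightarrow> 'w) \<Rightarrow> bool" where
  "category_C sG \<sigma> N sW \<rho> \<longleftrightarrow>
     (\<exists>p. p \<noteq> 0 \<and>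
       (\<forall>a. poly_mult_series N sW p (\<lambda>k. \<rho> (gen_series sG \<sigma> N a k)) \<in> calE sW))"


section \<open>The two parts of a representation\<close>

text \<open>The linear maps given on generating functions by
  \<open>\<pi>\<^sub>R (a(x) + \<alpha> \<^bold>k) = \<psi>\<^sub>R (\<pi> (a(x))) + \<alpha> \<pi> (\<^bold>k)\<close> and
  \<open>\<pi>\<^sub>E (a(x) + \<beta> \<^bold>k) = \<psi>\<^sub>E (\<pi> (a(x)))\<close>, coefficient by coefficient.\<close>

definition is_pi_R ::
    "(complex \<Rightarrow> 'g \<Rightarrow> 'g) \<Rightarrow> ('g \<Rightarrow> 'g) \<Rightarrow> nat \<Rightarrow> (complex \<Rightarrow> 'w \<Rightarrow> 'w) \<Rightarrow>
     ('g::ab_group_add affine \<Rightarrow> 'w::ab_group_add \<Rightarrow> 'w) \<Rightarrow> ('g affine \<Rightarrow> 'w \<Rightarrow> 'w) \<Rightarrow> bool" where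
  "is_pi_R sG \<sigma> N sW \<pi> \<pi>R \<longleftrightarrow>
     linear_to_End (affine_carrier sG \<sigma> N) (affine_scale sG) sW \<pi>R \<and>
     (\<forall>a \<alpha> k w.
        \<pi>R (gen_series sG \<sigma> N a k + const_series (affine_scale sG \<alpha> central) k) w =
        psi_R N sW (\<lambda>k. \<pi> (gen_series sG \<sigma> N a k)) k w
          + const_series (sW \<alpha> (\<pi> central w)) k)"

definition is_pi_E ::
    "(complex \<Rightarrow> 'g \<Rightarrow> 'g) \<Rightarrow> ('g \<Rightarrow> 'g) \<Rightarrow> nat \<Rightarrow> (complex \<Rightarrow> 'w \<Rightarrow> 'w) \<Rightarrow>
     ('g::ab_group_add affine \<Rightarrow> 'w::ab_group_add \<Rightarrow> 'w) \<Rightarrow> ('g affine \<Rightarrow> 'w \<Rightarrow> 'w) \<Rightarrow> bool" where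
  "is_pi_E sG \<sigma> N sW \<pi> \<pi>E \<longleftrightarrow>
     linear_to_End (affine_carrier sG \<sigma> N) (affine_scale sG) sW \<pi>E \<and>
     (\<forall>a \<beta> k w.
        \<pi>E (gen_series sG \<sigma> N a k + const_series (affine_scale sG \<beta> central) k) w =
        psi_E N sW (\<lambda>k. \<pi> (gen_series sG \<sigma> N a k)) k w)"

end

theory Submission
  imports Defs
begin

text \<open>Call a series torsion if a nonzero polynomial kills it.  A series that is both torsion and
  lower truncated vanishes, so \<open>\<psi>\<^sub>R (A(x)) w\<close> is characterized as the unique lower truncated
  series differing from \<open>A(x) w\<close> by a torsion series.  This characterization is stable under
  linear maps, sums and shifts.  Applied to \<open>[a(x), \<pi>(v)] = \<pi>([a(x), v])\<close>, whose right-hand side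
  is a shifted generating series plus a central term, uniqueness yields
  \<open>[\<pi>\<^sub>R u, \<pi> v] = \<pi>\<^sub>R [u, v]\<close>, and a second application yields \<open>[\<pi>\<^sub>R u, \<pi>\<^sub>R v] = \<pi>\<^sub>R [u, v]\<close>;
  all bracket relations for \<open>\<pi>\<^sub>R\<close> and \<open>\<pi>\<^sub>E = \<pi> - \<pi>\<^sub>R\<close> follow by linear algebra.  For a real root
  vector \<open>a\<close> the operators \<open>a(n)\<close> commute, and each coefficient of \<open>\<psi>\<^sub>R (a(x))\<close> acts on a given
  vector as a finite combination of them, which gives local nilpotence.\<close>

section \<open>Torsion series and lower truncated series\<close>

lemma funpow_zero:
  fixes T :: "'a \<Rightarrow> 'a::zero"
  assumes "T 0 = 0"
  shows "(T ^^ m) 0 = 0"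
  using assms by (induction m) auto

locale series_space = vector_space sW
  for sW :: "complex \<Rightarrow> 'w::ab_group_add \<Rightarrow> 'w" +
  fixes N :: nat
  assumes N_pos: "N > 0"
begin

text \<open>The product \<open>p(x) v(x)\<close> for a series with coefficients in \<open>W\<close>.
  The index \<open>k\<close> stands for the exponent \<open>k/N\<close>, so multiplication by
  \<open>x\<close> moves indices by \<open>N\<close>. Operator series enter through their values at
  a fixed vector.\<close>

definition poly_act :: "complex poly \<Rightarrow> (int \<Rightarrow> 'w) \<Rightarrow> int \<Rightarrow> 'w" where
  "poly_act p v k = (\<Sum>j\<le>degree p. sW (coeff p j) (v (k - int N * int j)))"

definition truncated :: "(int \<Rightarrow> 'w) \<Rightarrow> bool" where
  "truncated v \<longleftrightarrow> (\<exists>K. \<forall>k<K. v k = 0)"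

definition torsion :: "(int \<Rightarrow> 'w) \<Rightarrow> bool" where
  "torsion v \<longleftrightarrow> (\<exists>p. p \<noteq> 0 \<and> (\<forall>k. poly_act p v k = 0))"

text \<open>A relation instead of a function: the polynomial used to clear denominators never
  enters, so arguments by uniqueness can compare series cleared by different polynomials.\<close>

definition regular_part :: "(int \<Rightarrow> 'w) \<Rightarrow> (int \<Rightarrow> 'w) \<Rightarrow> bool" where
  "regular_part v u \<longleftrightarrow> truncated u \<and> torsion (\<lambda>k. v k - u k)"

abbreviation endo :: "('w \<Rightarrow> 'w) \<Rightarrow> bool" where
  "endo T \<equiv> Vector_Spaces.linear sW sW T"

lemma endo_iff: "endo T \<longleftrightarrow> (\<forall>x y. T (x + y) = T x + T y) \<and> (\<forall>c x. T (sW c x) = sW c (T x))"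
  by (simp add: Vector_Spaces.linear_iff vector_space_axioms)

lemma endoI:
  "(\<And>x y. T (x + y) = T x + T y) \<Longrightarrow> (\<And>c x. T (sW c x) = sW c (T x)) \<Longrightarrow> endo T"
  by (simp add: endo_iff)

lemma endo_add: "endo T \<Longrightarrow> T (x + y) = T x + T y"
  and endo_scale: "endo T \<Longrightarrow> T (sW c x) = sW c (T x)"
  by (simp_all add: endo_iff)

lemma endo_0: "endo T \<Longrightarrow> T 0 = 0"
  using endo_scale[of T 0 0] by simp

lemma endo_diff: "endo T \<Longrightarrow> T (x - y) = T x - T y"
  using endo_add[of T "x - y" y] by (simp add: algebra_simps)

lemma endo_sum: "endo T \<Longrightarrow> T (\<Sum>i\<in>A. f i) = (\<Sum>i\<in>A. T (f i))"
  by (induction A rule: infinite_finite_induct) (auto simp: endo_add endo_0)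

lemma endo_scaling: "endo (sW c)"
  by (rule endoI) (simp_all add: scale_right_distrib mult.commute)

section \<open>Multiplication of series by polynomials\<close>

lemma poly_act_bound:
  assumes "degree p \<le> n"
  shows "poly_act p v k = (\<Sum>j\<le>n. sW (coeff p j) (v (k - int N * int j)))"
  unfolding poly_act_def
  by (rule sum.mono_neutral_left) (use assms in \<open>auto simp: coeff_eq_0\<close>)

lemma poly_act_add_poly: "poly_act (p + q) v k = poly_act p v k + poly_act q v k"
  using degree_add_le_max[of p q]
  by (simp add: poly_act_bound[of _ "max (degree p) (degree q)"] scale_left_distrib sum.distrib)

lemma poly_act_smult: "poly_act (smult c p) v k = sW c (poly_act p v k)"
  using degree_smult_le[of c p]
  by (simp add: poly_act_bound[of _ "degree p"] scale_sum_right)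

lemma poly_act_0_poly [simp]: "poly_act 0 v k = 0"
  by (simp add: poly_act_def)

lemma poly_act_pCons: "poly_act (pCons c p) v k = sW c (v k) + poly_act p v (k - int N)"
proof -
  have "poly_act (pCons c p) v k =
      (\<Sum>j\<le>Suc (degree p). sW (coeff (pCons c p) j) (v (k - int N * int j)))"
    by (rule poly_act_bound) (rule degree_pCons_le)
  also have "\<dots> = sW c (v k) + poly_act p v (k - int N)"
    by (subst sum.atMost_Suc_shift) (simp add: poly_act_def algebra_simps)
  finally show ?thesis .
qed

lemma poly_act_series_shift: "poly_act p (\<lambda>k. v (k + d)) k = poly_act p v (k + d)"
  by (simp add: poly_act_def algebra_simps)

text \<open>Induction on \<open>p\<close> through the Horner recursion \<open>poly_act_pCons\<close>
  avoids reindexing a convolution.\<close>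

lemma poly_act_mult: "poly_act (p * q) v k = poly_act p (poly_act q v) k"
proof (induction p arbitrary: k)
  case 0
  show ?case by simp
next
  case (pCons c p)
  show ?case
    by (simp add: poly_act_add_poly poly_act_smult poly_act_pCons pCons)
qed

lemma poly_act_commute: "poly_act p (poly_act q v) k = poly_act q (poly_act p v) k"
  by (metis mult.commute poly_act_mult)

lemma poly_act_add: "poly_act p (\<lambda>k. u k + v k) k = poly_act p u k + poly_act p v k"
  by (simp add: poly_act_def scale_right_distrib sum.distrib)

lemma poly_act_endo: "endo T \<Longrightarrow> poly_act p (\<lambda>k. T (v k)) k = T (poly_act p v k)"
  by (simp add: poly_act_def endo_sum endo_scale)

lemma poly_act_diff: "poly_act p (\<lambda>k. u k - v k) k = poly_act p u k - poly_act p v k"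
  by (simp add: poly_act_def scale_right_diff_distrib sum_subtractf)

lemma poly_act_zero [simp]: "poly_act p (\<lambda>k. 0) k = 0"
  by (simp add: poly_act_def)

section \<open>Stability of truncated and torsion series\<close>

lemma truncated_add: "truncated u \<Longrightarrow> truncated v \<Longrightarrow> truncated (\<lambda>k. u k + v k)"
  unfolding truncated_def by (metis add.right_neutral min_less_iff_conj)

lemma truncated_diff: "truncated u \<Longrightarrow> truncated v \<Longrightarrow> truncated (\<lambda>k. u k - v k)"
  unfolding truncated_def by (metis diff_zero min_less_iff_conj)

lemma truncated_endo: "truncated v \<Longrightarrow> endo T \<Longrightarrow> truncated (\<lambda>k. T (v k))"
  unfolding truncated_def by (metis endo_0)

lemma truncated_shift: "truncated v \<Longrightarrow> truncated (\<lambda>k. v (k + d))"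
  unfolding truncated_def by (metis less_diff_eq)

lemma truncated_poly_act:
  assumes "truncated v"
  shows "truncated (poly_act p v)"
proof -
  obtain K where K: "\<And>k. k < K \<Longrightarrow> v k = 0"
    using assms unfolding truncated_def by blast
  have "poly_act p v k = 0" if "k < K" for k
    unfolding poly_act_def
  proof (intro sum.neutral ballI)
    fix j
    have "k - int N * int j < K"
      using that by (smt (verit) of_nat_0_le_iff of_nat_mult)
    then show "sW (coeff p j) (v (k - int N * int j)) = 0"
      by (simp add: K)
  qed
  then show ?thesis
    unfolding truncated_def by blast
qed

text \<open>The product of an annihilator of \<open>u\<close> and one of \<open>v\<close>
  annihilates both, and it is nonzero because \<open>\<complex>[x]\<close> is a domain.\<close>

lemma torsion_add:
  assumes "torsion u" "torsion v"
  shows "torsion (\<lambda>k. u k + v k)"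
proof -
  obtain p q where p: "p \<noteq> 0" "\<And>k. poly_act p u k = 0" and q: "q \<noteq> 0" "\<And>k. poly_act q v k = 0"
    using assms unfolding torsion_def by blast
  have "poly_act (p * q) u k = 0" for k
  proof -
    have "poly_act (p * q) u k = poly_act q (poly_act p u) k"
      by (metis mult.commute poly_act_mult)
    then show ?thesis by (simp add: p poly_act_def[of q])
  qed
  moreover have "poly_act (p * q) v k = 0" for k
    by (simp add: poly_act_mult q poly_act_def[of p])
  ultimately have "\<forall>k. poly_act (p * q) (\<lambda>k. u k + v k) k = 0"
    by (simp add: poly_act_add)
  then show ?thesis
    using p(1) q(1) unfolding torsion_def by (metis no_zero_divisors)
qed

lemma torsion_endo: "torsion v \<Longrightarrow> endo T \<Longrightarrow> torsion (\<lambda>k. T (v k))"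
  unfolding torsion_def by (metis endo_0 poly_act_endo)

lemma torsion_diff:
  assumes "torsion u" "torsion v"
  shows "torsion (\<lambda>k. u k - v k)"
  using torsion_add[OF assms(1) torsion_endo[OF assms(2) endo_scaling[of "-1"]]] by simp

lemma torsion_shift: "torsion v \<Longrightarrow> torsion (\<lambda>k. v (k + d))"
  unfolding torsion_def by (metis poly_act_series_shift)

text \<open>A polynomial in \<open>x\<close> shifts indices by multiples of \<open>N\<close> only,
  so its action preserves each residue class modulo \<open>N\<close>.\<close>

lemma torsion_mask:
  assumes "torsion v"
  shows "torsion (\<lambda>k. if k mod int N = r then v k else 0)"
proof -
  have "poly_act p (\<lambda>k. if k mod int N = r then v k else 0) k =
      (if k mod int N = r then poly_act p v k else 0)" for p k
    by (simp add: poly_act_def mod_diff_right_eq[symmetric] mod_mult_self1_is_0)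
  then show ?thesis
    using assms unfolding torsion_def by auto
qed

text \<open>The lowest term of \<open>p\<close> times the lowest term of \<open>v\<close> is the
  lowest term of the product and cannot cancel.\<close>

lemma torsion_truncated_eq_0:
  assumes "torsion v" "truncated v"
  shows "v k = 0"
proof (rule ccontr)
  assume "v k \<noteq> 0"
  obtain p where p: "p \<noteq> 0" "\<And>k. poly_act p v k = 0"
    using assms unfolding torsion_def by blast
  obtain K where K: "\<And>k. k < K \<Longrightarrow> v k = 0"
    using assms unfolding truncated_def by blast
  \<comment> \<open>\<open>K + m\<close> is the lowest index with a nonzero coefficient of
    \<open>v\<close>; counting from \<open>K\<close> makes \<open>LEAST\<close> over the naturals
    available.\<close>
  define m where "m = (LEAST m. v (K + int m) \<noteq> 0)"
  have "v (K + int (nat (k - K))) \<noteq> 0"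
    using K[of k] \<open>v k \<noteq> 0\<close> by (smt (verit) int_nat_eq)
  then have m: "v (K + int m) \<noteq> 0"
    unfolding m_def by (rule LeastI)
  have below: "v l = 0" if "l < K + int m" for l
  proof (cases "l < K")
    case False
    then have "nat (l - K) < m" "l = K + int (nat (l - K))"
      using that by auto
    then show ?thesis
      unfolding m_def using not_less_Least by metis
  qed (rule K)
  define s where "s = (LEAST s. coeff p s \<noteq> 0)"
  have "coeff p (degree p) \<noteq> 0"
    using p by simp
  then have s: "coeff p s \<noteq> 0"
    unfolding s_def by (rule LeastI)
  \<comment> \<open>At this index the terms with \<open>j < s\<close> vanish because of
    \<open>p\<close>, those with \<open>j > s\<close> because of \<open>v\<close>.\<close>
  have "poly_act p v (K + int m + int N * int s) =
      (\<Sum>j\<in>{s}. sW (coeff p j) (v (K + int m + int N * int s - int N * int j)))"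
    unfolding poly_act_def
  proof (rule sum.mono_neutral_right)
    show "{s} \<subseteq> {..degree p}"
      using s by (simp add: le_degree)
    show "\<forall>j\<in>{..degree p} - {s}. sW (coeff p j) (v (K + int m + int N * int s - int N * int j)) = 0"
    proof
      fix j assume "j \<in> {..degree p} - {s}"
      then consider "j < s" | "s < j" by fastforce
      then show "sW (coeff p j) (v (K + int m + int N * int s - int N * int j)) = 0"
      proof cases
        case 1
        then show ?thesis
          unfolding s_def using not_less_Least by fastforce
      next
        case 2
        then have "int N * int s < int N * int j"
          using N_pos by simp
        then show ?thesis by (simp add: below)
      qed
    qed
  qed simp
  also have "\<dots> = sW (coeff p s) (v (K + int m))"
    by simp
  finally show False
    using p(2) s m by simp
qed

lemma regular_part_unique: "regular_part v u \<Longrightarrow> regular_part v u' \<Longrightarrow> u k = u' k"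
proof -
  assume a: "regular_part v u" "regular_part v u'"
  have "torsion (\<lambda>k. (v k - u' k) - (v k - u k))"
    using a torsion_diff[of "\<lambda>k. v k - u' k" "\<lambda>k. v k - u k"] by (simp add: regular_part_def)
  then have "torsion (\<lambda>k. u k - u' k)" by simp
  moreover have "truncated (\<lambda>k. u k - u' k)"
    using a unfolding regular_part_def by (intro truncated_diff) auto
  ultimately have "u k - u' k = 0"
    by (rule torsion_truncated_eq_0)
  then show ?thesis by simp
qed

section \<open>Calculus of regular parts\<close>

lemma torsion_zero: "torsion (\<lambda>k. 0)"
  unfolding torsion_def by (metis poly_act_zero one_neq_zero)

lemma regular_part_self: "truncated v \<Longrightarrow> regular_part v v"
  by (simp add: regular_part_def torsion_zero)

lemma regular_part_add:
  assumes "regular_part v u" "regular_part v' u'"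
  shows "regular_part (\<lambda>k. v k + v' k) (\<lambda>k. u k + u' k)"
proof -
  have "torsion (\<lambda>k. (v k - u k) + (v' k - u' k))"
    using assms unfolding regular_part_def by (intro torsion_add) auto
  moreover have "(\<lambda>k. (v k - u k) + (v' k - u' k)) = (\<lambda>k. (v k + v' k) - (u k + u' k))"
    by (simp add: algebra_simps)
  ultimately show ?thesis
    using assms by (simp add: regular_part_def truncated_add)
qed

lemma regular_part_endo:
  assumes "regular_part v u" "endo T"
  shows "regular_part (\<lambda>k. T (v k)) (\<lambda>k. T (u k))"
  using assms torsion_endo[of "\<lambda>k. v k - u k" T]
  by (simp add: regular_part_def truncated_endo endo_diff)

lemma regular_part_diff:
  assumes "regular_part v u" "regular_part v' u'"
  shows "regular_part (\<lambda>k. v k - v' k) (\<lambda>k. u k - u' k)"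
  using regular_part_add[OF assms(1) regular_part_endo[OF assms(2) endo_scaling[of "-1"]]] by simp

lemma regular_part_shift:
  "regular_part v u \<Longrightarrow> regular_part (\<lambda>k. v (k + d)) (\<lambda>k. u (k + d))"
  unfolding regular_part_def using truncated_shift torsion_shift[of "\<lambda>k. v k - u k" d] by blast

lemma regular_part_mask:
  assumes "regular_part v u"
  shows "regular_part (\<lambda>k. if k mod int N = r then v k else 0)
    (\<lambda>k. if k mod int N = r then u k else 0)"
proof -
  have "(\<lambda>k. (if k mod int N = r then v k else 0) - (if k mod int N = r then u k else 0)) =
      (\<lambda>k. if k mod int N = r then v k - u k else 0)"
    by auto
  then show ?thesis
    using assms torsion_mask[of "\<lambda>k. v k - u k" r]
    unfolding regular_part_def truncated_def by auto
qed

section \<open>Multiplication by the Laurent expansion of \<open>1/f\<close>\<close>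

lemma fls_of_poly_times_nth:
  fixes f :: "complex poly" and l :: "complex fls"
  shows "fls_nth (fps_to_fls (fps_of_poly f) * l) n = (\<Sum>j\<le>degree f. coeff f j * fls_nth l (n - int j))"
proof -
  let ?F = "fps_to_fls (fps_of_poly f)"
  let ?A = "{fls_subdegree ?F..n - fls_subdegree l}" and ?B = "int ` {..degree f}"
  have "fls_nth (?F * l) n = (\<Sum>i\<in>?A. fls_nth ?F i * fls_nth l (n - i))"
    by (rule fls_times_nth(2))
  \<comment> \<open>One range is cut out by subdegrees, the other by the degree of \<open>f\<close>;
    neither need contain the other, so they are compared inside their union.\<close>
  also have "\<dots> = (\<Sum>i\<in>?A \<union> ?B. fls_nth ?F i * fls_nth l (n - i))"
    by (rule sum.mono_neutral_left) (auto dest: not_le_imp_less simp: fls_eq0_below_subdegree simp del: fps_to_fls_nth)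
  also have "\<dots> = (\<Sum>i\<in>?B. fls_nth ?F i * fls_nth l (n - i))"
  proof (rule sum.mono_neutral_right)
    show "\<forall>i\<in>?A \<union> ?B - ?B. fls_nth ?F i * fls_nth l (n - i) = 0"
    proof
      fix i assume "i \<in> ?A \<union> ?B - ?B"
      then have "i \<notin> ?B" by blast
      then have "i < 0 \<or> nat i > degree f"
        by (metis atMost_iff imageI int_nat_eq not_le)
      then show "fls_nth ?F i * fls_nth l (n - i) = 0"
        by (auto simp: coeff_eq_0)
    qed
  qed auto
  also have "\<dots> = (\<Sum>j\<le>degree f. coeff f j * fls_nth l (n - int j))"
    by (simp add: sum.reindex)
  finally show ?thesis .
qed

text \<open>The order of \<open>l\<close> bounds the summation index below and the truncation of
  \<open>t\<close> bounds it above. The free choice of \<open>I\<close> serves to align several such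
  sums on one range.\<close>

lemma fls_mult_series_eq_sum:
  assumes "\<And>m. m < K \<Longrightarrow> t m = 0" "a \<le> fls_subdegree l" "finite I" "{a..\<bar>k\<bar> + \<bar>K\<bar>} \<subseteq> I"
  shows "fls_mult_series N sW l t k = (\<Sum>j\<in>I. sW (fls_nth l j) (t (k - int N * j)))"
  unfolding fls_mult_series_def
proof (rule Sum_any.expand_superset)
  show "{j. sW (fls_nth l j) (t (k - int N * j)) \<noteq> 0} \<subseteq> I"
  proof
    fix j assume "j \<in> {j. sW (fls_nth l j) (t (k - int N * j)) \<noteq> 0}"
    then have "fls_nth l j \<noteq> 0" "t (k - int N * j) \<noteq> 0"
      by auto
    then have "fls_subdegree l \<le> j" "K \<le> k - int N * j"
      using fls_eq0_below_subdegree[of j l] assms(1)[of "k - int N * j"] by linarith+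
    moreover have "j \<le> \<bar>k\<bar> + \<bar>K\<bar>"
    proof (cases "j \<le> 0")
      case False
      then have "j \<le> int N * j"
        using N_pos by simp
      then show ?thesis using \<open>K \<le> k - int N * j\<close> by linarith
    qed linarith
    ultimately show "j \<in> I"
      using assms(2,4) by auto
  qed
qed (rule assms(3))

text \<open>Associativity \<open>f (l t) = (f l) t\<close> with \<open>f l = 1\<close>. The work
  lies in writing all coefficients of \<open>l t\<close> that occur over one finite range, so that
  the two sums can be exchanged.\<close>

lemma poly_act_fls_mult_inverse:
  assumes "f \<noteq> 0" "truncated t"
  shows "poly_act f (fls_mult_series N sW (inverse (fps_to_fls (fps_of_poly f))) t) k = t k"
proof -
  define l where "l = inverse (fps_to_fls (fps_of_poly f))"
  have fl: "fps_to_fls (fps_of_poly f) * l = 1"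
    using assms by (simp add: l_def)
  obtain K where K: "\<And>m. m < K \<Longrightarrow> t m = 0"
    using assms unfolding truncated_def by blast
  \<comment> \<open>The minimum with 0 puts the index 0 into \<open>I\<close>; there the product
    \<open>f l = 1\<close> has its only nonzero coefficient.\<close>
  define d where "d = min 0 (fls_subdegree l)"
  define I where "I = {d..\<bar>k\<bar> + \<bar>K\<bar>}"
  have inner: "fls_mult_series N sW l t (k - int N * int j) =
      (\<Sum>n\<in>I. sW (fls_nth l (n - int j)) (t (k - int N * n)))" for j
  proof -
    \<comment> \<open>The extra \<open>\<bar>k\<bar>\<close> makes \<open>J\<close>, shifted by
      \<open>j\<close>, contain \<open>I\<close>.\<close>
    define J where "J = {d - int j..\<bar>k - int N * int j\<bar> + \<bar>K\<bar> + \<bar>k\<bar>}"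
    have "fls_mult_series N sW l t (k - int N * int j) =
        (\<Sum>i\<in>J. sW (fls_nth l i) (t (k - int N * int j - int N * i)))"
      by (rule fls_mult_series_eq_sum[of K _ d]) (auto simp: K d_def J_def)
    also have "\<dots> = (\<Sum>n\<in>(\<lambda>i. i + int j) ` J. sW (fls_nth l (n - int j)) (t (k - int N * n)))"
      by (subst sum.reindex) (auto simp: algebra_simps intro!: sum.cong)
    also have "\<dots> = (\<Sum>n\<in>(\<lambda>i. i + int j) ` J \<union> I. sW (fls_nth l (n - int j)) (t (k - int N * n)))"
    proof (rule sum.mono_neutral_left)
      show "\<forall>n\<in>(\<lambda>i. i + int j) ` J \<union> I - (\<lambda>i. i + int j) ` J.
          sW (fls_nth l (n - int j)) (t (k - int N * n)) = 0"
      proof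
        fix n assume "n \<in> (\<lambda>i. i + int j) ` J \<union> I - (\<lambda>i. i + int j) ` J"
        then have "n \<in> I" and "n - int j \<notin> J"
          by force+
        then have "n - int j > \<bar>k - int N * int j\<bar> + \<bar>K\<bar> + \<bar>k\<bar>"
          by (auto simp: J_def I_def)
        then show "sW (fls_nth l (n - int j)) (t (k - int N * n)) = 0"
          using \<open>n \<in> I\<close> by (auto simp: I_def)
      qed
    qed (auto simp: J_def I_def)
    also have "\<dots> = (\<Sum>n\<in>I. sW (fls_nth l (n - int j)) (t (k - int N * n)))"
    proof (rule sum.mono_neutral_right)
      show "\<forall>n\<in>(\<lambda>i. i + int j) ` J \<union> I - I. sW (fls_nth l (n - int j)) (t (k - int N * n)) = 0"
      proof
        fix n assume "n \<in> (\<lambda>i. i + int j) ` J \<union> I - I"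
        then consider "n < d" | "n > \<bar>k\<bar> + \<bar>K\<bar>"
          by (auto simp: I_def)
        then show "sW (fls_nth l (n - int j)) (t (k - int N * n)) = 0"
        proof cases
          case 1
          then show ?thesis by (simp add: d_def fls_eq0_below_subdegree)
        next
          case 2
          \<comment> \<open>Here \<open>k - N n \<le> k - n < K\<close>, so \<open>t\<close>
            vanishes.\<close>
          then have "n \<le> int N * n"
            using N_pos mult_right_mono[of 1 "int N" n] by simp
          then show ?thesis
            using 2 by (simp add: K)
        qed
      qed
    qed (auto simp: J_def I_def)
    finally show ?thesis .
  qed
  have "poly_act f (fls_mult_series N sW l t) k =
      (\<Sum>j\<le>degree f. \<Sum>n\<in>I. sW (coeff f j * fls_nth l (n - int j)) (t (k - int N * n)))"
    by (simp add: poly_act_def inner scale_sum_right)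
  also have "\<dots> = (\<Sum>n\<in>I. sW (fls_nth (fps_to_fls (fps_of_poly f) * l) n) (t (k - int N * n)))"
    by (subst sum.swap) (simp add: fls_of_poly_times_nth scale_sum_left)
  also have "\<dots> = (\<Sum>n\<in>I. if n = 0 then t k else 0)"
    by (intro sum.cong) (auto simp: fl)
  also have "\<dots> = t k"
    by (simp add: I_def d_def)
  finally show ?thesis
    by (simp add: l_def)
qed

lemma truncated_fls_mult:
  assumes "truncated t"
  shows "truncated (fls_mult_series N sW l t)"
proof -
  obtain K where K: "\<And>m. m < K \<Longrightarrow> t m = 0"
    using assms unfolding truncated_def by blast
  have "fls_mult_series N sW l t k = 0" if k: "k < K + int N * fls_subdegree l" for k
  proof -
    have "sW (fls_nth l j) (t (k - int N * j)) = 0" for j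
    proof (cases "j < fls_subdegree l")
      case False
      then have "int N * fls_subdegree l \<le> int N * j"
        by (simp add: mult_left_mono)
      then show ?thesis
        using k by (simp add: K)
    qed (simp add: fls_eq0_below_subdegree)
    then show ?thesis
      unfolding fls_mult_series_def by (simp only: Sum_any.neutral)
  qed
  then show ?thesis
    unfolding truncated_def by blast
qed

text \<open>With \<open>u\<close> the quotient, \<open>f u = f v\<close>, so \<open>f\<close> itself
  annihilates \<open>v - u\<close>.\<close>

lemma regular_part_fls_mult:
  assumes "f \<noteq> 0" "truncated (poly_act f v)"
  shows "regular_part v (fls_mult_series N sW (inverse (fps_to_fls (fps_of_poly f))) (poly_act f v))"
  unfolding regular_part_def torsion_def
  using assms by (auto simp: truncated_fls_mult poly_act_diff poly_act_fls_mult_inverse intro!: exI[of _ f])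

text \<open>Only finitely many coefficients of \<open>v\<close> contribute to each coefficient of
  the quotient. Local nilpotence of the parts of a representation rests on this.\<close>

lemma fls_mult_poly_act_in_span:
  assumes "truncated (poly_act f v)"
  shows "fls_mult_series N sW l (poly_act f v) k \<in> span (range v)"
proof -
  obtain K where K: "\<And>m. m < K \<Longrightarrow> poly_act f v m = 0"
    using assms unfolding truncated_def by blast
  have "fls_mult_series N sW l (poly_act f v) k =
      (\<Sum>j\<in>{fls_subdegree l..\<bar>k\<bar> + \<bar>K\<bar>}. sW (fls_nth l j) (poly_act f v (k - int N * j)))"
    by (rule fls_mult_series_eq_sum) (auto simp: K)
  then show ?thesis
    unfolding poly_act_def by (auto intro!: span_sum span_scale intro: span_base)
qed

text \<open>A lower truncated multiple of \<open>v\<close> and the same multiple of its regular part differ by a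
  series that is both torsion and lower truncated.\<close>

lemma poly_act_regular_part:
  assumes "regular_part v u" "truncated (poly_act p v)"
  shows "poly_act p (\<lambda>k. v k - u k) k = 0"
proof (rule torsion_truncated_eq_0)
  obtain q where q: "q \<noteq> 0" "\<And>k. poly_act q (\<lambda>k. v k - u k) k = 0"
    using assms unfolding regular_part_def torsion_def by blast
  have "poly_act q (poly_act p (\<lambda>k. v k - u k)) k = 0" for k
    by (subst poly_act_commute) (simp add: q poly_act_def[of p])
  then show "torsion (poly_act p (\<lambda>k. v k - u k))"
    using q(1) unfolding torsion_def by blast
  have "truncated (\<lambda>k. poly_act p v k - poly_act p u k)"
    using assms by (auto simp: regular_part_def intro: truncated_diff truncated_poly_act)
  then show "truncated (poly_act p (\<lambda>k. v k - u k))"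
    by (simp add: poly_act_diff[abs_def])
qed

section \<open>The map \<open>psi_R\<close> as a regular part\<close>

lemma poly_mult_series_eq: "poly_mult_series N sW p A k w = poly_act p (\<lambda>k. A k w) k"
  by (simp add: poly_mult_series_def poly_act_def)

lemma truncated_if_calE: "poly_mult_series N sW p A \<in> calE sW \<Longrightarrow> truncated (poly_act p (\<lambda>k. A k w))"
  by (auto simp: calE_def truncated_def poly_mult_series_eq)

text \<open>The polynomial chosen by \<open>SOME\<close> depends on \<open>A\<close> but not on
  \<open>w\<close> or \<open>k\<close>; the given \<open>p\<close> only guarantees that the choice
  is meaningful.\<close>

lemma psi_R_regular_part:
  assumes "p \<noteq> 0" "poly_mult_series N sW p A \<in> calE sW"
  shows "regular_part (\<lambda>k. A k w) (\<lambda>k. psi_R N sW A k w)" (is ?reg)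
    and "psi_R N sW A k w \<in> span (range (\<lambda>k. A k w))" (is ?span)
proof -
  define f where "f = (SOME f. f \<noteq> 0 \<and> poly_mult_series N sW f A \<in> calE sW)"
  have f: "f \<noteq> 0" "truncated (poly_act f (\<lambda>k. A k w))"
    using someI[of "\<lambda>f. f \<noteq> 0 \<and> poly_mult_series N sW f A \<in> calE sW" p] assms truncated_if_calE
    unfolding f_def by blast+
  have eq: "psi_R N sW A k w =
      fls_mult_series N sW (inverse (fps_to_fls (fps_of_poly f))) (poly_act f (\<lambda>k. A k w)) k" for k
    unfolding psi_R_def f_def[symmetric] Let_def poly_mult_series_eq by simp
  show ?reg ?span
    unfolding eq using f by (auto intro: regular_part_fls_mult fls_mult_poly_act_in_span)
qed

section \<open>Local nilpotence\<close>

definition locally_nilpotent :: "('w \<Rightarrow> 'w) \<Rightarrow> bool" where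
  "locally_nilpotent T \<longleftrightarrow> (\<forall>w. \<exists>m. (T ^^ m) w = 0)"

lemma funpow_eq_0_mono:
  assumes "endo T" "(T ^^ m) w = 0" "m \<le> n"
  shows "(T ^^ n) w = 0"
proof -
  have "(T ^^ n) w = (T ^^ (n - m)) ((T ^^ m) w)"
    using assms(3) by (simp flip: funpow_add[unfolded o_def, THEN fun_cong])
  then show ?thesis
    using assms(2) endo_0[OF assms(1)] by (simp add: funpow_zero)
qed

lemma endo_funpow: "endo T \<Longrightarrow> endo (T ^^ m)"
  by (induction m) (auto simp: endo_iff)

lemma endo_plus: "endo S \<Longrightarrow> endo T \<Longrightarrow> endo (\<lambda>w. S w + T w)"
  by (auto simp: endo_iff scale_right_distrib algebra_simps)

text \<open>One application of \<open>S + T\<close> to \<open>w\<close> gives \<open>S w\<close>,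
  killed by one power of \<open>S\<close> less, plus \<open>T w\<close>, killed by one power of
  \<open>T\<close> less. Induction on the sum of the two exponents replaces the binomial
  theorem.\<close>

lemma locally_nilpotent_add:
  assumes S: "endo S" "locally_nilpotent S" and T: "endo T" "locally_nilpotent T"
    and comm: "\<And>w. S (T w) = T (S w)"
  shows "locally_nilpotent (\<lambda>w. S w + T w)"
proof -
  let ?U = "\<lambda>w. S w + T w"
  have U: "endo ?U"
    using S T by (simp add: endo_plus)
  have commS: "(S ^^ a) (T w) = T ((S ^^ a) w)" for a w
    by (induction a) (auto simp: comm)
  have commT: "(T ^^ a) (S w) = S ((T ^^ a) w)" for a w
    by (induction a) (auto simp: comm)
  have "\<exists>m. (?U ^^ m) w = 0" if "(S ^^ a) w = 0" "(T ^^ b) w = 0" for a b w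
    using that
  proof (induction "a + b" arbitrary: a b w)
    case 0
    then show ?case by (auto intro: exI[of _ 0])
  next
    case (Suc n)
    show ?case
    proof (cases "a = 0 \<or> b = 0")
      case True
      then show ?thesis using Suc.prems by (auto intro: exI[of _ 0])
    next
      case False
      then obtain a' b' where ab: "a = Suc a'" "b = Suc b'"
        by (meson not0_implies_Suc)
      have "(S ^^ a') (S w) = 0" "(T ^^ b) (S w) = 0"
        using Suc.prems ab commT[of b w]
        by (simp_all add: endo_0[OF S(1)] funpow_Suc_right del: funpow.simps)
      then obtain m where m: "(?U ^^ m) (S w) = 0"
        using Suc.hyps(1)[of a' b "S w"] Suc.hyps(2) ab by auto
      have "(S ^^ a) (T w) = 0" "(T ^^ b') (T w) = 0"
        using Suc.prems ab commS[of a w]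
        by (simp_all add: endo_0[OF T(1)] funpow_Suc_right del: funpow.simps)
      then obtain m' where m': "(?U ^^ m') (T w) = 0"
        using Suc.hyps(1)[of a b' "T w"] Suc.hyps(2) ab by auto
      have "(?U ^^ Suc (max m m')) w = (?U ^^ max m m') (S w + T w)"
        by (simp only: funpow_Suc_right o_def)
      also have "\<dots> = (?U ^^ max m m') (S w) + (?U ^^ max m m') (T w)"
        by (rule endo_add[OF endo_funpow[OF U]])
      also have "\<dots> = 0"
        using funpow_eq_0_mono[OF U m] funpow_eq_0_mono[OF U m'] by simp
      finally show ?thesis by blast
    qed
  qed
  then show ?thesis
    using S(2) T(2) unfolding locally_nilpotent_def by meson
qed

lemma locally_nilpotent_scale:
  assumes "endo T" "locally_nilpotent T"
  shows "locally_nilpotent (\<lambda>w. sW c (T w))"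
proof -
  have "((\<lambda>w. sW c (T w)) ^^ m) w = sW (c ^ m) ((T ^^ m) w)" for m w
    by (induction m) (auto simp: endo_scale[OF assms(1)])
  then show ?thesis
    using assms(2) unfolding locally_nilpotent_def by (metis scale_zero_right)
qed

text \<open>Linearity is carried through the induction because adding the next summand requires it
  of the sum so far.\<close>

lemma locally_nilpotent_sum:
  assumes "finite F" "\<And>i. i \<in> F \<Longrightarrow> endo (A i)" "\<And>i. i \<in> F \<Longrightarrow> locally_nilpotent (A i)"
    and "\<And>i j w. i \<in> F \<Longrightarrow> j \<in> F \<Longrightarrow> A i (A j w) = A j (A i w)"
  shows "endo (\<lambda>w. \<Sum>i\<in>F. sW (c i) (A i w)) \<and> locally_nilpotent (\<lambda>w. \<Sum>i\<in>F. sW (c i) (A i w))"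
  using assms
proof (induction F rule: finite_induct)
  case empty
  show ?case by (auto simp: locally_nilpotent_def endo_iff intro: exI[of _ 1])
next
  case (insert x F)
  let ?S = "\<lambda>w. sW (c x) (A x w)" and ?T = "\<lambda>w. \<Sum>i\<in>F. sW (c i) (A i w)"
  have S: "endo ?S" "locally_nilpotent ?S"
    using insert.prems endo_iff[of "A x"]
    by (auto simp: locally_nilpotent_scale endo_iff scale_right_distrib mult.commute)
  have T: "endo ?T" "locally_nilpotent ?T"
    using insert by auto
  have "?S (?T w) = ?T (?S w)" for w
    using insert.prems by (simp add: endo_sum endo_scale scale_sum_right mult.commute)
  from locally_nilpotent_add[OF S T this] endo_plus[OF S(1) T(1)] show ?case
    using insert.hyps by simp
qed

text \<open>\<open>B\<close> acts on \<open>w\<close> as a finite combination \<open>T\<close> of the \<open>A i\<close>; since \<open>B\<close> commutes with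
  \<open>T\<close>, the same \<open>T\<close> computes all powers of \<open>B\<close> on \<open>w\<close>.\<close>

lemma locally_nilpotent_span:
  fixes A :: "'i \<Rightarrow> 'w \<Rightarrow> 'w"
  assumes A: "\<And>i. endo (A i)" "\<And>i. locally_nilpotent (A i)" "\<And>i j w. A i (A j w) = A j (A i w)"
    and B: "endo B" "\<And>i w. B (A i w) = A i (B w)" "\<And>w. B w \<in> span (range (\<lambda>i. A i w))"
  shows "locally_nilpotent B"
  unfolding locally_nilpotent_def
proof
  fix w
  have "\<exists>c F. finite F \<and> u = (\<Sum>i\<in>F. sW (c i) (A i w))" if "u \<in> span (range (\<lambda>i. A i w))" for u
    using that
  proof (induction rule: span_induct_alt)
    case base
    \<comment> \<open>Over the empty index set any coefficient function will do.\<close>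
    show ?case by (rule exI[of _ undefined], rule exI[of _ "{}"]) simp
  next
    case (step a x y)
    then obtain i c F where x: "x = A i w" and F: "finite F" "y = (\<Sum>i\<in>F. sW (c i) (A i w))"
      by auto
    \<comment> \<open>The new index \<open>i\<close> may already lie in \<open>F\<close>, in which
      case the two coefficients must be added.\<close>
    define c' where "c' = (\<lambda>j. (if j = i then a else 0) + (if j \<in> F then c j else 0))"
    have "(\<Sum>j\<in>insert i F. sW (c' j) (A j w)) =
        (\<Sum>j\<in>insert i F. if j = i then sW a (A j w) else 0) +
        (\<Sum>j\<in>insert i F. if j \<in> F then sW (c j) (A j w) else 0)"
      unfolding sum.distrib[symmetric]
      by (intro sum.cong) (auto simp: c'_def scale_left_distrib)
    also have "(\<Sum>j\<in>insert i F. if j = i then sW a (A j w) else 0) = sW a x"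
      using F x by simp
    also have "(\<Sum>j\<in>insert i F. if j \<in> F then sW (c j) (A j w) else 0) = y"
      unfolding F(2) by (rule sum.mono_neutral_cong_right) (use F in auto)
    finally have "sW a x + y = (\<Sum>j\<in>insert i F. sW (c' j) (A j w))" ..
    then show ?case
      using F(1) by (intro exI[of _ c'] exI[of _ "insert i F"]) simp
  qed
  then obtain c F where F: "finite F" "B w = (\<Sum>i\<in>F. sW (c i) (A i w))"
    using B(3) by blast
  define T where "T = (\<lambda>w. \<Sum>i\<in>F. sW (c i) (A i w))"
  have T: "endo T" "locally_nilpotent T"
    unfolding T_def using locally_nilpotent_sum[OF F(1), of A c] A by auto
  have Bw: "B w = T w"
    using F(2) by (simp add: T_def)
  have BT: "B (T u) = T (B u)" for u
    using B(1,2) by (simp add: T_def endo_sum endo_scale)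
  have "(B ^^ r) w = (T ^^ r) w" for r
  proof (induction r)
    case (Suc r)
    have "(B ^^ Suc r) w = B ((T ^^ r) w)"
      using Suc by simp
    also have "\<dots> = (T ^^ r) (B w)"
    proof (induction r)
      case (Suc r)
      then show ?case by (simp add: BT)
    qed simp
    also have "\<dots> = (T ^^ Suc r) w"
      using Bw by (simp add: funpow_swap1)
    finally show ?case .
  qed simp
  then show "\<exists>m. (B ^^ m) w = 0"
    using T(2) by (auto simp: locally_nilpotent_def)
qed

end

section \<open>The grading and the affine bracket\<close>

context twisted_affine_data
begin

abbreviation (input) "\<omega> \<equiv> root_of_unity N"

lemma bracket_add_left: "bracket (x + y) z = bracket x z + bracket y z"
  and bracket_scale_left: "bracket (sG c x) z = sG c (bracket x z)"
  using bracket_linear_left[of z] by (simp_all add: Vector_Spaces.linear_iff)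

lemma bracket_add_right: "bracket z (x + y) = bracket z x + bracket z y"
  and bracket_scale_right: "bracket z (sG c x) = sG c (bracket z x)"
  using bracket_linear_right[of z] by (simp_all add: Vector_Spaces.linear_iff)

lemma bracket_0_left [simp]: "bracket 0 z = 0" and bracket_0_right [simp]: "bracket z 0 = 0"
  using bracket_scale_left[of 0 0 z] bracket_scale_right[of z 0 0] by simp_all

lemma bracket_antisym: "bracket x y = - bracket y x"
proof -
  have "bracket (x + y) (x + y) = bracket x y + bracket y x"
    unfolding bracket_add_left bracket_add_right by (simp add: bracket_self add.commute)
  then show ?thesis
    by (simp add: bracket_self eq_neg_iff_add_eq_0)
qed

lemma form_add_left: "form (x + y) z = form x z + form y z"
  and form_scale_left: "form (sG c x) z = c * form x z"
  using form_linear_left[of z] by (simp_all add: Vector_Spaces.linear_iff)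

lemma form_add_right: "form z (x + y) = form z x + form z y"
  and form_scale_right: "form z (sG c x) = c * form z x"
  using form_linear_right[of z] by (simp_all add: Vector_Spaces.linear_iff)

lemma form_0_left [simp]: "form 0 z = 0" and form_0_right [simp]: "form z 0 = 0"
  using form_scale_left[of 0 0 z] form_scale_right[of z 0 0] by simp_all

lemma \<sigma>_add: "\<sigma> (x + y) = \<sigma> x + \<sigma> y" and \<sigma>_scale: "\<sigma> (sG c x) = sG c (\<sigma> x)"
  using \<sigma>_linear by (simp_all add: Vector_Spaces.linear_iff)

lemma \<sigma>_0 [simp]: "\<sigma> 0 = 0"
  using \<sigma>_scale[of 0 0] by simp

lemma \<sigma>_sum: "\<sigma> (\<Sum>i\<in>A. f i) = (\<Sum>i\<in>A. \<sigma> (f i))"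
  by (induction A rule: infinite_finite_induct) (auto simp: \<sigma>_add)

lemma \<sigma>_pow_add: "(\<sigma> ^^ k) (x + y) = (\<sigma> ^^ k) x + (\<sigma> ^^ k) y"
  and \<sigma>_pow_scale: "(\<sigma> ^^ k) (sG c x) = sG c ((\<sigma> ^^ k) x)"
  and \<sigma>_pow_bracket: "(\<sigma> ^^ k) (bracket x y) = bracket ((\<sigma> ^^ k) x) ((\<sigma> ^^ k) y)"
  by (induction k) (auto simp: \<sigma>_add \<sigma>_scale \<sigma>_bracket)

section \<open>Roots of unity and the eigenspaces of \<sigma>\<close>

lemma root_eq_cis: "\<omega> = cis (2 * pi / real N)"
  by (simp add: root_of_unity_def cis_conv_exp algebra_simps)

lemma root_nonzero [simp]: "\<omega> \<noteq> 0"
  by (simp add: root_of_unity_def)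

lemma root_pow_N: "\<omega> ^ N = 1"
  using N_pos by (simp add: root_eq_cis DeMoivre)

lemma root_powi_mod: "\<omega> powi (i mod int N) = \<omega> powi i"
proof -
  have "\<omega> powi i = \<omega> powi (int N * (i div int N) + i mod int N)"
    by simp
  also have "\<dots> = (\<omega> powi int N) powi (i div int N) * \<omega> powi (i mod int N)"
    by (simp only: power_int_add power_int_mult root_nonzero simp_thms)
  also have "\<dots> = \<omega> powi (i mod int N)"
    by (simp add: root_pow_N)
  finally show ?thesis ..
qed

text \<open>Primitivity of \<open>\<omega>\<close>: after reduction of \<open>i\<close> to an
  exponent below \<open>N\<close>, the claim follows since the \<open>N\<close> roots of unity are
  pairwise distinct.\<close>

lemma root_powi_eq_1_iff: "\<omega> powi i = 1 \<longleftrightarrow> i mod int N = 0"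
proof
  assume "\<omega> powi i = 1"
  then have "\<omega> powi (i mod int N) = 1"
    by (simp add: root_powi_mod)
  moreover define j where "j = nat (i mod int N)"
  have j: "j < N" "i mod int N = int j"
    using N_pos by (simp_all add: j_def nat_less_iff)
  ultimately have "cis (2 * pi * real j / real N) = cis (2 * pi * real 0 / real N)"
    by (simp add: root_eq_cis DeMoivre mult.commute)
  moreover have "inj_on (\<lambda>k. cis (2 * pi * real k / real N)) {..<N}"
    using bij_betw_roots_unity[OF N_pos] by (rule bij_betw_imp_inj_on)
  ultimately have "j = 0"
    using j(1) N_pos by (metis inj_onD lessThan_iff)
  then show "i mod int N = 0"
    using j by simp
next
  assume "i mod int N = 0"
  then show "\<omega> powi i = 1"
    using root_powi_mod[of i] by simp
qed

text \<open>Orthogonality of characters: a geometric sum whose ratio \<open>\<omega> powi i\<close>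
  has \<open>N\<close>-th power 1.\<close>

lemma sum_root_powers:
  "(\<Sum>k<N. \<omega> powi (i * int k)) = (if i mod int N = 0 then of_nat N else 0)"
proof -
  have *: "\<omega> powi (i * int k) = (\<omega> powi i) ^ k" for k
    by (simp add: power_int_power')
  show ?thesis
  proof (cases "i mod int N = 0")
    case True
    then show ?thesis
      unfolding * using root_powi_eq_1_iff[of i] by simp
  next
    case False
    have "(\<omega> powi i) ^ N = (\<omega> ^ N) powi i"
      by (simp add: power_int_power power_int_power' mult.commute)
    then have "(\<omega> powi i) ^ N = 1"
      by (simp add: root_pow_N)
    then show ?thesis
      unfolding * using False root_powi_eq_1_iff[of i] by (simp add: geometric_sum)
  qed
qed

lemma grade_0: "0 \<in> grade sG \<sigma> N i"
  by (simp add: grade_def)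

lemma grade_add: "a \<in> grade sG \<sigma> N i \<Longrightarrow> b \<in> grade sG \<sigma> N i \<Longrightarrow> a + b \<in> grade sG \<sigma> N i"
  by (simp add: grade_def \<sigma>_add scale_right_distrib)

lemma grade_scale: "a \<in> grade sG \<sigma> N i \<Longrightarrow> sG c a \<in> grade sG \<sigma> N i"
  by (simp add: grade_def \<sigma>_scale mult.commute)

lemma grade_bracket:
  "a \<in> grade sG \<sigma> N i \<Longrightarrow> b \<in> grade sG \<sigma> N j \<Longrightarrow> bracket a b \<in> grade sG \<sigma> N (i + j)"
  by (simp add: grade_def \<sigma>_bracket bracket_scale_left bracket_scale_right power_int_add)

lemma grade_mod: "grade sG \<sigma> N (i mod int N) = grade sG \<sigma> N i"
  by (simp add: grade_def root_powi_mod)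

text \<open>The projection to \<open>\<gg>\<^sub>i\<close> is a discrete Fourier transform.\<close>

definition grade_proj :: "int \<Rightarrow> 'g \<Rightarrow> 'g" where
  "grade_proj i a = sG (1 / of_nat N) (\<Sum>k<N. sG (\<omega> powi (- i * int k)) ((\<sigma> ^^ k) a))"

lemma grade_proj_add: "grade_proj i (a + b) = grade_proj i a + grade_proj i b"
  by (simp add: grade_proj_def \<sigma>_pow_add scale_right_distrib sum.distrib)

lemma grade_proj_scale: "grade_proj i (sG c a) = sG c (grade_proj i a)"
  by (simp add: grade_proj_def \<sigma>_pow_scale scale_sum_right mult_ac)

lemma grade_proj_0 [simp]: "grade_proj i 0 = 0"
  using grade_proj_scale[of i 0 0] by simp

lemma grade_proj_sum: "grade_proj i (\<Sum>x\<in>A. f x) = (\<Sum>x\<in>A. grade_proj i (f x))"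
  by (induction A rule: infinite_finite_induct) (auto simp: grade_proj_add)

lemma grade_proj_mod: "grade_proj (i mod int N) a = grade_proj i a"
proof -
  have "\<omega> powi (- (i mod int N) * int k) = \<omega> powi (- i * int k)" for k
    by (metis mod_minus_eq mod_mult_left_eq root_powi_mod)
  then show ?thesis
    by (simp add: grade_proj_def)
qed

text \<open>Applying \<open>\<sigma>\<close> moves each summand to the next one, up to the factor
  \<open>\<omega> powi i\<close>; as \<open>h N = h 0\<close>, the sum is cyclic and only the factor
  remains.\<close>

lemma grade_proj_in_grade: "grade_proj i a \<in> grade sG \<sigma> N i"
proof -
  define h where "h k = sG (\<omega> powi (- i * int k)) ((\<sigma> ^^ k) a)" for k
  have "\<omega> powi (- i * int N) = 1"
    by (simp add: root_powi_eq_1_iff)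
  then have "h N = h 0"
    by (simp add: h_def \<sigma>_pow_N)
  then have shift: "(\<Sum>k<N. h (Suc k)) = (\<Sum>k<N. h k)"
    using sum.lessThan_Suc_shift[of h N] sum.lessThan_Suc[of h N] by (simp add: add.commute)
  have "\<sigma> (h k) = sG (\<omega> powi i) (h (Suc k))" for k
    by (simp add: h_def \<sigma>_scale algebra_simps flip: power_int_add)
  then have "\<sigma> (\<Sum>k<N. h k) = sG (\<omega> powi i) (\<Sum>k<N. h k)"
    by (simp add: \<sigma>_sum shift flip: scale_sum_right)
  then have "(\<Sum>k<N. h k) \<in> grade sG \<sigma> N i"
    by (simp add: grade_def)
  then show ?thesis
    unfolding grade_proj_def h_def by (rule grade_scale)
qed

lemma grade_proj_of_grade:
  assumes "a \<in> grade sG \<sigma> N j"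
  shows "grade_proj i a = (if (j - i) mod int N = 0 then a else 0)"
proof -
  have "(\<sigma> ^^ k) a = sG (\<omega> powi (j * int k)) a" for k
    by (induction k) (use assms in
      \<open>auto simp: grade_def \<sigma>_scale algebra_simps simp flip: power_int_add\<close>)
  then have "grade_proj i a = sG (1 / of_nat N) (sG (\<Sum>k<N. \<omega> powi ((j - i) * int k)) a)"
    by (simp add: grade_proj_def scale_sum_left algebra_simps flip: power_int_add)
  then show ?thesis
    using N_pos by (simp add: sum_root_powers)
qed

text \<open>If the sum over \<open>i\<close> is taken first, orthogonality leaves only the term
  \<open>k = 0\<close>, which is \<open>N\<close> times \<open>a\<close>.\<close>

lemma sum_grade_proj: "(\<Sum>i\<in>{0..<int N}. grade_proj i a) = a"
proof -
  have "(\<Sum>i\<in>{0..<int N}. \<omega> powi (- i * int k)) = (if k = 0 then of_nat N else 0)" if "k < N" for k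
  proof -
    have "(\<Sum>i\<in>{0..<int N}. \<omega> powi (- i * int k)) = (\<Sum>i<N. \<omega> powi (- int k * int i))"
      by (rule sum.reindex_bij_witness[of _ int nat]) (auto simp: mult.commute)
    moreover have "- int k mod int N = 0 \<longleftrightarrow> k = 0"
      using that by (auto simp: zmod_zminus1_eq_if)
    ultimately show ?thesis
      using sum_root_powers[of "- int k"] by simp
  qed
  then have "(\<Sum>k<N. \<Sum>i\<in>{0..<int N}. sG (\<omega> powi (- i * int k)) ((\<sigma> ^^ k) a)) =
      (\<Sum>k<N. if k = 0 then sG (of_nat N) a else 0)"
    by (intro sum.cong) (auto simp flip: scale_sum_left)
  also have "\<dots> = sG (of_nat N) a"
    using N_pos by simp
  finally show ?thesis
    using N_pos unfolding grade_proj_def scale_sum_right[symmetric]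
    by (subst sum.swap) simp
qed

text \<open>The description by \<open>THE\<close> also demands uniqueness: applying
  \<open>grade_proj j\<close> to a decomposition of \<open>a\<close> recovers its
  \<open>j\<close>-th component.\<close>

lemma graded_part_eq:
  "graded_part sG \<sigma> N a i = (if i \<in> {0..<int N} then grade_proj i a else 0)"
proof -
  have "graded_part sG \<sigma> N a = (\<lambda>i. if i \<in> {0..<int N} then grade_proj i a else 0)"
    unfolding graded_part_def
  proof (rule the_equality)
    fix d assume d: "(\<forall>i\<in>{0..<int N}. d i \<in> grade sG \<sigma> N i) \<and>
      (\<forall>i. i \<notin> {0..<int N} \<longrightarrow> d i = 0) \<and> (\<Sum>i\<in>{0..<int N}. d i) = a"
    have "grade_proj j a = d j" if "j \<in> {0..<int N}" for j
    proof -
      have "grade_proj j a = (\<Sum>i\<in>{0..<int N}. grade_proj j (d i))"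
        using d by (auto simp flip: grade_proj_sum)
      also have "\<dots> = (\<Sum>i\<in>{0..<int N}. if i = j then d i else 0)"
      proof (rule sum.cong)
        fix i assume i: "i \<in> {0..<int N}"
        then have "(i - j) mod int N = 0 \<longleftrightarrow> i = j"
          using that by (metis atLeastLessThan_iff mod_eq_dvd_iff mod_pos_pos_trivial mod_0_imp_dvd dvd_imp_mod_0)
        then show "grade_proj j (d i) = (if i = j then d i else 0)"
          using d i by (simp add: grade_proj_of_grade[of _ i])
      qed simp
      finally show ?thesis using that by simp
    qed
    then show "d = (\<lambda>i. if i \<in> {0..<int N} then grade_proj i a else 0)"
      using d by auto
  qed (auto simp: grade_proj_in_grade sum_grade_proj)
  then show ?thesis by simp
qed

text \<open>Periodicity of \<open>grade_proj\<close> absorbs the reduction modulo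
  \<open>N\<close>.\<close>

lemma gen_series_eq: "gen_series sG \<sigma> N a k = monomial (grade_proj (- k - int N) a) (- k - int N)"
  using N_pos unfolding gen_series_def graded_part_eq grade_proj_mod by simp

text \<open>\<open>\<sigma> ^^ k\<close> multiplies \<open>b\<close> by
  \<open>\<omega> powi (j * k)\<close>, which turns the character for degree \<open>i + j\<close>
  into the one for degree \<open>i\<close>.\<close>

lemma grade_proj_bracket:
  assumes "b \<in> grade sG \<sigma> N j"
  shows "grade_proj (i + j) (bracket a b) = bracket (grade_proj i a) b"
proof -
  have b: "(\<sigma> ^^ k) b = sG (\<omega> powi (j * int k)) b" for k
    by (induction k) (use assms in
      \<open>auto simp: grade_def \<sigma>_scale algebra_simps simp flip: power_int_add\<close>)
  have br_sum: "bracket (\<Sum>x\<in>A. f x) b = (\<Sum>x\<in>A. bracket (f x) b)" for f and A :: "nat set"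
    by (induction A rule: infinite_finite_induct) (auto simp: bracket_add_left)
  show ?thesis
    by (simp add: grade_proj_def \<sigma>_pow_bracket b bracket_scale_left bracket_scale_right br_sum
        algebra_simps flip: power_int_add)
qed

section \<open>Carrier and bracket of the twisted affine algebra\<close>

abbreviation "L \<equiv> affine_carrier sG \<sigma> N"
abbreviation "sL \<equiv> affine_scale sG"
abbreviation "br \<equiv> affine_bracket bracket form N"

lemma lookup_map_scale: "Poly_Mapping.lookup (Poly_Mapping.map (sG c) f) n = sG c (Poly_Mapping.lookup f n)"
  by (simp add: Poly_Mapping.map.rep_eq when_def)

lemma carrier_monomial: "a \<in> grade sG \<sigma> N n \<Longrightarrow> monomial a n \<in> L"
  by (auto simp: affine_carrier_def monomial_def Poly_Mapping.lookup_single when_def grade_0)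

lemma carrier_central: "(0, c) \<in> L"
  by (simp add: affine_carrier_def grade_0)

lemma carrier_add: "u \<in> L \<Longrightarrow> v \<in> L \<Longrightarrow> u + v \<in> L"
  by (auto simp: affine_carrier_def lookup_add grade_add)

lemma carrier_gen_series: "gen_series sG \<sigma> N a k \<in> L"
  by (simp add: gen_series_eq carrier_monomial grade_proj_in_grade)

lemma scale_central: "sL c central = (0, c)"
  unfolding affine_scale_def central_def
  by (auto intro!: poly_mapping_eqI simp: lookup_map_scale)

lemma scale_monomial: "sL c (monomial a n) = monomial (sG c a) n"
  by (simp add: affine_scale_def monomial_def)

lemma monomial_add: "monomial (a + b) n = monomial a n + monomial b n"
  by (simp add: monomial_def Poly_Mapping.single_add)

text \<open>Every element of \<open>L\<close> is a finite sum of homogeneous monomials plus a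
  central term. The case \<open>add\<close> supplies membership in \<open>L\<close> because
  representations are additive only there.\<close>

lemma carrier_induct [consumes 1, case_names monomial central add]:
  assumes "u \<in> L"
    and mon: "\<And>a n. a \<in> grade sG \<sigma> N n \<Longrightarrow> P (monomial a n)"
    and cen: "\<And>c. P (0, c)"
    and add: "\<And>u v. u \<in> L \<Longrightarrow> v \<in> L \<Longrightarrow> P u \<Longrightarrow> P v \<Longrightarrow> P (u + v)"
  shows "P u"
proof -
  obtain f c where u: "u = (f, c)"
    by (cases u)
  have f: "Poly_Mapping.lookup f n \<in> grade sG \<sigma> N n" for n
    using assms(1) by (simp add: u affine_carrier_def)
  have "P (\<Sum>n\<in>A. Poly_Mapping.single n (Poly_Mapping.lookup f n), c) \<and>
      (\<Sum>n\<in>A. Poly_Mapping.single n (Poly_Mapping.lookup f n), c) \<in> L" if "finite A" for A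
    using that
  proof (induction A)
    case empty
    then show ?case by (simp add: cen carrier_central)
  next
    case (insert n A)
    have "(\<Sum>n\<in>insert n A. Poly_Mapping.single n (Poly_Mapping.lookup f n), c) =
        monomial (Poly_Mapping.lookup f n) n + (\<Sum>n\<in>A. Poly_Mapping.single n (Poly_Mapping.lookup f n), c)"
      using insert by (simp add: monomial_def)
    then show ?case
      using insert f by (auto intro!: add mon carrier_add carrier_monomial)
  qed
  moreover have "(\<Sum>n\<in>Poly_Mapping.keys f. Poly_Mapping.single n (Poly_Mapping.lookup f n)) = f"
    by (rule poly_mapping_eqI)
      (auto simp: lookup_sum Poly_Mapping.lookup_single when_def in_keys_iff)
  ultimately show ?thesis
    unfolding u by (metis finite_keys)
qed

text \<open>Terms outside the supports vanish, so the brackets of \<open>u\<close>,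
  \<open>u'\<close> and \<open>u + u'\<close> with \<open>v\<close> can be computed over a common
  range; additivity is then termwise.\<close>

lemma bracket_eq_sum:
  assumes "finite A" "Poly_Mapping.keys f \<subseteq> A" "finite B" "Poly_Mapping.keys g \<subseteq> B"
  shows "br (f, c) (g, d) =
    (\<Sum>m\<in>A. \<Sum>n\<in>B.
        Poly_Mapping.single (m + n) (bracket (Poly_Mapping.lookup f m) (Poly_Mapping.lookup g n)),
      \<Sum>m\<in>A. \<Sum>n\<in>B.
        if m = - n
        then of_int m / of_nat N * form (Poly_Mapping.lookup f m) (Poly_Mapping.lookup g n)
        else 0)"
proof -
  have *: "(\<Sum>m\<in>Poly_Mapping.keys f. \<Sum>n\<in>Poly_Mapping.keys g. h m n) = (\<Sum>m\<in>A. \<Sum>n\<in>B. h m n)"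
    if "\<And>m n. Poly_Mapping.lookup f m = 0 \<or> Poly_Mapping.lookup g n = 0 \<Longrightarrow> h m n = 0"
    for h :: "int \<Rightarrow> int \<Rightarrow> 'b::comm_monoid_add"
  proof -
    have "(\<Sum>m\<in>Poly_Mapping.keys f. \<Sum>n\<in>Poly_Mapping.keys g. h m n) =
        (\<Sum>m\<in>Poly_Mapping.keys f. \<Sum>n\<in>B. h m n)"
      using assms that by (intro sum.cong sum.mono_neutral_left) (auto simp: in_keys_iff)
    also have "\<dots> = (\<Sum>m\<in>A. \<Sum>n\<in>B. h m n)"
      using assms that by (intro sum.mono_neutral_left) (auto simp: in_keys_iff)
    finally show ?thesis .
  qed
  show ?thesis
    unfolding affine_bracket_def prod.case by (intro arg_cong2[of _ _ _ _ Pair] *) auto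
qed

lemma affine_bracket_add_left: "br (u + u') v = br u v + br u' v"
proof -
  obtain f c f' c' g d where e: "u = (f, c)" "u' = (f', c')" "v = (g, d)"
    by (cases u; cases u'; cases v)
  let ?A = "Poly_Mapping.keys f \<union> Poly_Mapping.keys f'" and ?B = "Poly_Mapping.keys g"
  have "Poly_Mapping.keys (f + f') \<subseteq> ?A"
    by (rule keys_add)
  then show ?thesis
    by (simp add: e bracket_eq_sum[of ?A _ ?B] lookup_add bracket_add_left form_add_left
        Poly_Mapping.single_add sum.distrib flip: sum.distrib)
      (auto intro!: sum.cong simp: lookup_add form_add_left form_add_right algebra_simps
        add_divide_distrib)
qed

lemma affine_bracket_add_right: "br v (u + u') = br v u + br v u'"
proof -
  obtain f c f' c' g d where e: "u = (f, c)" "u' = (f', c')" "v = (g, d)"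
    by (cases u; cases u'; cases v)
  let ?A = "Poly_Mapping.keys f \<union> Poly_Mapping.keys f'" and ?B = "Poly_Mapping.keys g"
  have "Poly_Mapping.keys (f + f') \<subseteq> ?A"
    by (rule keys_add)
  then show ?thesis
    by (simp add: e bracket_eq_sum[of ?B _ ?A] lookup_add bracket_add_right form_add_right
        Poly_Mapping.single_add flip: sum.distrib)
      (auto intro!: sum.cong simp: lookup_add form_add_left form_add_right algebra_simps
        add_divide_distrib)
qed

lemma affine_bracket_monomial:
  "br (monomial a m) (monomial b n) = monomial (bracket a b) (m + n) +
     (0, if m = - n then of_int m / of_nat N * form a b else 0)"
  unfolding monomial_def by (subst bracket_eq_sum[of "{m}" _ "{n}"]) auto

lemma affine_bracket_central [simp]: "br u (0, c) = 0" "br (0, c) u = 0"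
  by (cases u; simp add: affine_bracket_def zero_prod_def)+

text \<open>On monomials the central term survives only for \<open>m = - n\<close>; exchanging the
  arguments then changes the sign of the coefficient and leaves the symmetric form alone.\<close>

lemma affine_bracket_antisym:
  assumes "u \<in> L" "v \<in> L"
  shows "br u v = - br v u"
  using assms(1)
proof (induction rule: carrier_induct)
  case (monomial a m)
  show ?case
    using assms(2)
  proof (induction rule: carrier_induct)
    case (monomial b n)
    show ?case
      by (subst (1 2) affine_bracket_monomial)
        (simp add: monomial_def form_sym[of b a] bracket_antisym[of b a] single_uminus add.commute)
  qed (simp_all add: affine_bracket_add_left affine_bracket_add_right)
qed (simp_all add: affine_bracket_add_left affine_bracket_add_right)

lemma carrier_bracket:
  assumes "u \<in> L" "v \<in> L"
  shows "br u v \<in> L"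
  using assms(1)
proof (induction rule: carrier_induct)
  case (monomial a m)
  note a = monomial
  show ?case
    using assms(2)
  proof (induction rule: carrier_induct)
    case (monomial b n)
    then show ?case
      using a by (simp add: affine_bracket_monomial carrier_add carrier_monomial carrier_central grade_bracket)
  next
    case (central c)
    show ?case using carrier_central[of 0] by (simp add: zero_prod_def)
  next
    case (add v w)
    then show ?case by (simp add: affine_bracket_add_right carrier_add)
  qed
next
  case (central c)
  show ?case using carrier_central[of 0] by (simp add: zero_prod_def)
next
  case (add v w)
  then show ?case by (simp add: affine_bracket_add_left carrier_add)
qed

section \<open>Generating series\<close>

lemma gen_series_add: "gen_series sG \<sigma> N (a + b) k = gen_series sG \<sigma> N a k + gen_series sG \<sigma> N b k"
  by (simp add: gen_series_eq grade_proj_add monomial_add)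

lemma gen_series_scale: "gen_series sG \<sigma> N (sG c a) k = sL c (gen_series sG \<sigma> N a k)"
  by (simp add: gen_series_eq grade_proj_scale scale_monomial)

lemma monomial_eq_gen_series:
  "a \<in> grade sG \<sigma> N n \<Longrightarrow> monomial a n = gen_series sG \<sigma> N a (- n - int N)"
  by (simp add: gen_series_eq grade_proj_of_grade)

lemma monomial_0 [simp]: "monomial (0 :: 'g) n = 0"
  by (simp add: monomial_def zero_prod_def)

text \<open>Passing to a homogeneous component of \<open>a\<close> masks the generating series to
  one residue class, an operation compatible with regular parts.\<close>

lemma gen_series_grade_proj:
  "gen_series sG \<sigma> N (grade_proj (- l - int N) a) k =
    (if k mod int N = l mod int N then gen_series sG \<sigma> N a k else 0)"
proof -
  have *: "(- l - int N - (- k - int N)) mod int N = 0 \<longleftrightarrow> k mod int N = l mod int N"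
    by (simp add: mod_eq_dvd_iff dvd_eq_mod_eq_0)
  show ?thesis
  proof (cases "k mod int N = l mod int N")
    case True
    then have "grade_proj (- l - int N) a = grade_proj (- k - int N) a"
      by (metis grade_proj_mod mod_diff_cong mod_minus_cong)
    then show ?thesis
      using True * by (simp add: gen_series_eq grade_proj_of_grade[OF grade_proj_in_grade])
  next
    case False
    then show ?thesis
      using * by (simp add: gen_series_eq grade_proj_of_grade[OF grade_proj_in_grade])
  qed
qed

text \<open>In series notation, the bracket of \<open>a(x)\<close> with \<open>b t^(n/N)\<close> is
  \<open>x^(n/N) [a,b](x)\<close> plus one central term. That term sits at the index
  \<open>n - N\<close>, where \<open>a(x)\<close> has its \<open>t^(-n/N)\<close> component.\<close>

lemma gen_series_bracket:
  assumes "b \<in> grade sG \<sigma> N n"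
  shows "br (gen_series sG \<sigma> N a k) (monomial b n) = gen_series sG \<sigma> N (bracket a b) (k - n) +
    (if k = n - int N then (0, - of_int n / of_nat N * form (grade_proj (- n) a) b) else 0)"
proof -
  have "grade_proj (n - k - int N) (bracket a b) = bracket (grade_proj (- k - int N) a) b"
    using grade_proj_bracket[OF assms, of "- k - int N" a] by (simp add: algebra_simps)
  then show ?thesis
    by (auto simp: gen_series_eq affine_bracket_monomial zero_prod_def algebra_simps)
      (simp add: minus_divide_left algebra_simps)
qed

end

section \<open>Splitting a representation\<close>

locale category_C_rep = twisted_affine_data sG bracket form \<sigma> N + W: series_space sW N
  for sG :: "complex \<Rightarrow> 'g::ab_group_add \<Rightarrow> 'g" and bracket form \<sigma> N
    and sW :: "complex \<Rightarrow> 'w::ab_group_add \<Rightarrow> 'w" +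
  fixes \<pi> :: "'g affine \<Rightarrow> 'w \<Rightarrow> 'w"
  assumes rep: "lie_rep L sL br sW \<pi>"
    and category_C: "category_C sG \<sigma> N sW \<pi>"
begin

abbreviation "gen \<equiv> gen_series sG \<sigma> N"
abbreviation "\<psi> a \<equiv> psi_R N sW (\<lambda>k. \<pi> (gen a k))"

lemma \<pi>_linear: "linear_to_End L sL sW \<pi>"
  using rep by (simp add: lie_rep_def)

lemma \<pi>_endo: "u \<in> L \<Longrightarrow> W.endo (\<pi> u)"
  and \<pi>_add: "u \<in> L \<Longrightarrow> v \<in> L \<Longrightarrow> \<pi> (u + v) w = \<pi> u w + \<pi> v w"
  and \<pi>_scale: "u \<in> L \<Longrightarrow> \<pi> (sL c u) w = sW c (\<pi> u w)"
  using \<pi>_linear by (auto simp: linear_to_End_def)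

lemma \<pi>_bracket: "u \<in> L \<Longrightarrow> v \<in> L \<Longrightarrow> \<pi> (br u v) w = \<pi> u (\<pi> v w) - \<pi> v (\<pi> u w)"
  using rep by (auto simp: lie_rep_def)

lemma carrier_0: "0 \<in> L"
  using carrier_central[of 0] by (simp add: zero_prod_def)

lemma \<pi>_0: "\<pi> 0 w = 0"
  using \<pi>_add[OF carrier_0 carrier_0, of w] by simp

lemma \<pi>_central: "\<pi> (0, c) w = sW c (\<pi> central w)"
  using \<pi>_scale[of central c w] carrier_central[of 1] by (simp add: scale_central central_def[symmetric])

lemma \<pi>_central_endo: "W.endo (\<pi> central)"
  using \<pi>_endo[of central] carrier_central[of 1] by (simp add: central_def)

lemma \<pi>_central_comm: "u \<in> L \<Longrightarrow> \<pi> central (\<pi> u w) = \<pi> u (\<pi> central w)"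
  using \<pi>_bracket[of central u w] carrier_central[of 1] by (simp add: central_def \<pi>_0)

lemma psi_R_regular: "W.regular_part (\<lambda>k. \<pi> (gen a k) w) (\<lambda>k. \<psi> a k w)"
  and psi_R_span: "\<psi> a k w \<in> W.span (range (\<lambda>k. \<pi> (gen a k) w))"
  using category_C W.psi_R_regular_part unfolding category_C_def by blast+

lemma psi_R_endo: "W.endo (\<psi> a k)"
proof (rule W.endoI)
  fix x y
  have "W.regular_part (\<lambda>k. \<pi> (gen a k) (x + y)) (\<lambda>k. \<psi> a k x + \<psi> a k y)"
    using W.regular_part_add[OF psi_R_regular[of a x] psi_R_regular[of a y]]
    by (simp add: W.endo_add[OF \<pi>_endo[OF carrier_gen_series]])
  from W.regular_part_unique[OF psi_R_regular this]
  show "\<psi> a k (x + y) = \<psi> a k x + \<psi> a k y" .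
next
  fix c x
  have "W.regular_part (\<lambda>k. \<pi> (gen a k) (sW c x)) (\<lambda>k. sW c (\<psi> a k x))"
    using W.regular_part_endo[OF psi_R_regular[of a x] W.endo_scaling[of c]]
    by (simp add: W.endo_scale[OF \<pi>_endo[OF carrier_gen_series]])
  from W.regular_part_unique[OF psi_R_regular this]
  show "\<psi> a k (sW c x) = sW c (\<psi> a k x)" .
qed

text \<open>The polynomials chosen for \<open>a\<close>, \<open>b\<close> and \<open>a + b\<close>
  may differ, so additivity comes from uniqueness of regular parts and not from the formula for
  \<open>psi_R\<close>.\<close>

lemma psi_R_add: "\<psi> (a + b) k w = \<psi> a k w + \<psi> b k w"
proof -
  have "W.regular_part (\<lambda>k. \<pi> (gen (a + b) k) w) (\<lambda>k. \<psi> a k w + \<psi> b k w)"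
    using W.regular_part_add[OF psi_R_regular[of a w] psi_R_regular[of b w]]
    by (simp add: gen_series_add \<pi>_add carrier_gen_series)
  from W.regular_part_unique[OF psi_R_regular this] show ?thesis .
qed

lemma psi_R_scale: "\<psi> (sG c a) k w = sW c (\<psi> a k w)"
proof -
  have "W.regular_part (\<lambda>k. \<pi> (gen (sG c a) k) w) (\<lambda>k. sW c (\<psi> a k w))"
    using W.regular_part_endo[OF psi_R_regular[of a w] W.endo_scaling[of c]]
    by (simp add: gen_series_scale \<pi>_scale carrier_gen_series)
  from W.regular_part_unique[OF psi_R_regular this] show ?thesis .
qed

lemma psi_R_0 [simp]: "\<psi> 0 k w = 0"
  using psi_R_scale[of 0 0 k w] by simp

text \<open>The coefficient of \<open>a(x)\<close> at \<open>k\<close> sees only one homogeneous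
  component of \<open>a\<close>; masking transfers this to regular parts. It reconciles values given
  on monomials with those prescribed on whole generating series.\<close>

lemma psi_R_grade_proj: "\<psi> (grade_proj (- k - int N) a) k w = \<psi> a k w"
proof -
  have "W.regular_part (\<lambda>l. \<pi> (gen (grade_proj (- k - int N) a) l) w)
      (\<lambda>l. if l mod int N = k mod int N then \<psi> a l w else 0)"
    using W.regular_part_mask[OF psi_R_regular[of a w], of "k mod int N"]
    by (simp add: gen_series_grade_proj \<pi>_0 if_distrib[of "\<lambda>u. \<pi> u w"] cong: if_cong)
  from W.regular_part_unique[OF psi_R_regular this, of k] show ?thesis by simp
qed

section \<open>Existence of the two maps\<close>

lemma const_series_central: "const_series (sL c central) k = (0, if k = 0 then c else 0)"
  by (simp add: const_series_def scale_central zero_prod_def)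

text \<open>A homogeneous \<open>a t^(n/N)\<close> is the coefficient of \<open>a(x)\<close> at the
  index \<open>- n - N\<close>, whence the second argument of \<open>\<psi>\<close>.\<close>

definition pi_R :: "'g affine \<Rightarrow> 'w \<Rightarrow> 'w" where
  "pi_R u w = (\<Sum>n\<in>Poly_Mapping.keys (fst u). \<psi> (Poly_Mapping.lookup (fst u) n) (- n - int N) w)
    + sW (snd u) (\<pi> central w)"

lemma pi_R_eq_sum:
  assumes "finite A" "Poly_Mapping.keys (fst u) \<subseteq> A"
  shows "pi_R u w = (\<Sum>n\<in>A. \<psi> (Poly_Mapping.lookup (fst u) n) (- n - int N) w)
    + sW (snd u) (\<pi> central w)"
proof -
  have "(\<Sum>n\<in>Poly_Mapping.keys (fst u). \<psi> (Poly_Mapping.lookup (fst u) n) (- n - int N) w) =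
      (\<Sum>n\<in>A. \<psi> (Poly_Mapping.lookup (fst u) n) (- n - int N) w)"
    by (rule sum.mono_neutral_left) (use assms in \<open>auto simp: in_keys_iff\<close>)
  then show ?thesis
    by (simp add: pi_R_def)
qed

lemma pi_R_linear: "linear_to_End L sL sW pi_R"
  unfolding linear_to_End_def
proof (intro conjI ballI allI)
  fix u assume "u \<in> L"
  show "W.endo (pi_R u)"
    by (rule W.endoI)
      (simp_all add: pi_R_def W.endo_add[OF psi_R_endo] W.endo_scale[OF psi_R_endo]
        W.endo_add[OF \<pi>_central_endo] W.endo_scale[OF \<pi>_central_endo] sum.distrib
        W.scale_sum_right W.scale_right_distrib mult.commute algebra_simps)
next
  fix u v :: "'g affine" and w
  let ?A = "Poly_Mapping.keys (fst u) \<union> Poly_Mapping.keys (fst v)"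
  have A: "Poly_Mapping.keys (fst u + fst v) \<subseteq> ?A"
    by (rule keys_add)
  show "pi_R (u + v) w = pi_R u w + pi_R v w"
    using A by (simp add: pi_R_eq_sum[of ?A] lookup_add psi_R_add sum.distrib W.scale_left_distrib algebra_simps)
next
  fix c and u :: "'g affine" and w
  have fst_snd: "fst (sL c u) = Poly_Mapping.map (sG c) (fst u)" "snd (sL c u) = c * snd u"
    by (simp_all add: affine_scale_def split: prod.splits)
  have "Poly_Mapping.keys (fst (sL c u)) \<subseteq> Poly_Mapping.keys (fst u)"
    unfolding fst_snd by (auto simp: in_keys_iff lookup_map_scale)
  then have "pi_R (sL c u) w = (\<Sum>n\<in>Poly_Mapping.keys (fst u).
      \<psi> (Poly_Mapping.lookup (fst (sL c u)) n) (- n - int N) w) + sW (snd (sL c u)) (\<pi> central w)"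
    by (intro pi_R_eq_sum) auto
  then show "pi_R (sL c u) w = sW c (pi_R u w)"
    by (simp add: pi_R_def fst_snd lookup_map_scale psi_R_scale W.scale_right_distrib W.scale_sum_right)
qed

lemma is_pi_R_pi_R: "is_pi_R sG \<sigma> N sW \<pi> pi_R"
  unfolding is_pi_R_def
proof (intro conjI allI)
  fix a \<alpha> k w
  let ?n = "- k - int N"
  have "pi_R (gen a k + const_series (sL \<alpha> central) k) w =
      \<psi> (grade_proj ?n a) k w + sW (if k = 0 then \<alpha> else 0) (\<pi> central w)"
    by (subst pi_R_eq_sum[of "{?n}"])
      (auto simp: gen_series_eq monomial_def const_series_central split: if_splits)
  then show "pi_R (gen a k + const_series (sL \<alpha> central) k) w =
      \<psi> a k w + const_series (sW \<alpha> (\<pi> central w)) k"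
    by (simp add: psi_R_grade_proj const_series_def)
qed (rule pi_R_linear)

text \<open>The witness is \<open>\<pi> - pi_R\<close>: the central contributions of both cancel, so
  the value does not depend on \<beta>.\<close>

lemma ex_pi_E: "\<exists>\<pi>E. is_pi_E sG \<sigma> N sW \<pi> \<pi>E"
proof
  define \<pi>E where "\<pi>E = (\<lambda>u w. \<pi> u w - pi_R u w)"
  have "linear_to_End L sL sW \<pi>E"
    using \<pi>_linear pi_R_linear
    by (auto simp: linear_to_End_def \<pi>E_def W.endo_iff W.scale_right_diff_distrib)
  moreover have "\<pi>E (gen a k + const_series (sL \<beta> central) k) w =
      psi_E N sW (\<lambda>k. \<pi> (gen a k)) k w" for a \<beta> k w
  proof -
    have "\<pi> (gen a k + const_series (sL \<beta> central) k) w =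
        \<pi> (gen a k) w + const_series (sW \<beta> (\<pi> central w)) k"
      by (simp add: \<pi>_add carrier_gen_series const_series_central carrier_central \<pi>_central)
        (simp add: const_series_def)
    moreover have "pi_R (gen a k + const_series (sL \<beta> central) k) w =
        \<psi> a k w + const_series (sW \<beta> (\<pi> central w)) k"
      using is_pi_R_pi_R by (simp add: is_pi_R_def)
    ultimately show ?thesis
      by (simp add: \<pi>E_def psi_E_def)
  qed
  ultimately show "is_pi_E sG \<sigma> N sW \<pi> \<pi>E"
    by (simp add: is_pi_E_def)
qed

end

text \<open>Arbitrary maps with the two defining properties are considered, since these properties
  fix values on \<open>L\<close> only.\<close>

locale split_rep = category_C_rep +
  fixes \<pi>R \<pi>E
  assumes is_R: "is_pi_R sG \<sigma> N sW \<pi> \<pi>R"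
    and is_E: "is_pi_E sG \<sigma> N sW \<pi> \<pi>E"
begin

lemma \<pi>R_linear: "linear_to_End L sL sW \<pi>R" and \<pi>E_linear: "linear_to_End L sL sW \<pi>E"
  using is_R is_E by (simp_all add: is_pi_R_def is_pi_E_def)

lemma \<pi>R_endo: "u \<in> L \<Longrightarrow> W.endo (\<pi>R u)"
  and \<pi>R_add: "u \<in> L \<Longrightarrow> v \<in> L \<Longrightarrow> \<pi>R (u + v) w = \<pi>R u w + \<pi>R v w"
  and \<pi>R_scale: "u \<in> L \<Longrightarrow> \<pi>R (sL c u) w = sW c (\<pi>R u w)"
  using \<pi>R_linear by (auto simp: linear_to_End_def)

lemma \<pi>E_endo: "u \<in> L \<Longrightarrow> W.endo (\<pi>E u)"
  and \<pi>E_add: "u \<in> L \<Longrightarrow> v \<in> L \<Longrightarrow> \<pi>E (u + v) w = \<pi>E u w + \<pi>E v w"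
  and \<pi>E_scale: "u \<in> L \<Longrightarrow> \<pi>E (sL c u) w = sW c (\<pi>E u w)"
  using \<pi>E_linear by (auto simp: linear_to_End_def)

lemma \<pi>R_0: "\<pi>R 0 w = 0"
  using \<pi>R_add[OF carrier_0 carrier_0, of w] by simp

lemma gen_0: "gen 0 k = 0"
  by (simp add: gen_series_eq)

lemma \<pi>R_gen: "\<pi>R (gen a k) w = \<psi> a k w"
proof -
  have "\<pi>R (gen a k + const_series (sL 0 central) k) w = \<psi> a k w + const_series (sW 0 (\<pi> central w)) k"
    using is_R unfolding is_pi_R_def by blast
  moreover have "const_series (sL 0 central) k = (0 :: 'a affine)"
    by (simp add: const_series_central flip: zero_prod_def)
  ultimately show ?thesis
    by (simp add: const_series_def)
qed

lemma \<pi>R_central: "\<pi>R (0, c) w = sW c (\<pi> central w)"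
proof -
  have "\<pi>R (gen 0 0 + const_series (sL c central) 0) w = \<psi> 0 0 w + const_series (sW c (\<pi> central w)) 0"
    using is_R unfolding is_pi_R_def by blast
  then show ?thesis
    unfolding const_series_central psi_R_0 by (simp add: gen_0 const_series_def)
qed

lemma \<pi>E_gen: "\<pi>E (gen a k) w = \<pi> (gen a k) w - \<psi> a k w"
proof -
  have "\<pi>E (gen a k + const_series (sL 0 central) k) w = psi_E N sW (\<lambda>k. \<pi> (gen a k)) k w"
    using is_E unfolding is_pi_E_def by blast
  then show ?thesis
    by (simp add: const_series_central psi_E_def flip: zero_prod_def)
qed

lemma \<pi>E_central: "\<pi>E (0, c) w = 0"
proof -
  have "\<pi>E (gen 0 0 + const_series (sL c central) 0) w = psi_E N sW (\<lambda>k. \<pi> (gen 0 k)) 0 w"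
    using is_E unfolding is_pi_E_def by blast
  then show ?thesis
    by (simp add: const_series_central psi_E_def \<pi>_0 gen_0) (use psi_R_0[of 0 w] in \<open>simp add: gen_0\<close>)
qed

text \<open>On generating series this is the definition of \<open>psi_E\<close>; on central elements
  \<open>\<pi>R\<close> agrees with \<open>\<pi>\<close> while \<open>\<pi>E\<close>
  vanishes.\<close>

lemma \<pi>E_eq: "u \<in> L \<Longrightarrow> \<pi>E u w = \<pi> u w - \<pi>R u w"
proof (induction arbitrary: w rule: carrier_induct)
  case (monomial a n)
  then show ?case
    by (simp add: monomial_eq_gen_series \<pi>E_gen \<pi>R_gen)
next
  case (central c)
  show ?case by (simp add: \<pi>E_central \<pi>R_central \<pi>_central)
next
  case (add u v)
  then show ?case by (simp add: \<pi>E_add \<pi>R_add \<pi>_add)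
qed

lemma \<pi>R_regular: "W.regular_part (\<lambda>k. \<pi> (gen a k) w) (\<lambda>k. \<pi>R (gen a k) w)"
  unfolding \<pi>R_gen by (rule psi_R_regular)

lemma \<pi>R_central_comm: "u \<in> L \<Longrightarrow> \<pi> central (\<pi>R u w) = \<pi>R u (\<pi> central w)"
proof (induction arbitrary: w rule: carrier_induct)
  case (monomial a n)
  have "W.regular_part (\<lambda>k. \<pi> (gen a k) (\<pi> central w)) (\<lambda>k. \<pi> central (\<pi>R (gen a k) w))"
    using W.regular_part_endo[OF \<pi>R_regular \<pi>_central_endo, of a w]
    by (simp add: \<pi>_central_comm carrier_gen_series)
  from W.regular_part_unique[OF this \<pi>R_regular] show ?case
    using monomial by (simp add: monomial_eq_gen_series)
next
  case (central c)
  show ?case by (simp add: \<pi>R_central W.endo_scale[OF \<pi>_central_endo])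
next
  case (add u v)
  then show ?case by (simp add: \<pi>R_add W.endo_add[OF \<pi>_central_endo])
qed

section \<open>Commutation relations\<close>

lemma truncated_point: "W.truncated (\<lambda>k. if k = d then w else 0)"
  unfolding W.truncated_def by (intro exI[of _ d]) auto

text \<open>The bracket is a shifted generating series plus a single central coefficient. The latter
  is truncated, hence its own regular part, and \<open>\<pi>\<close> and \<open>\<pi>R\<close> agree
  on it.\<close>

lemma regular_part_bracket:
  assumes "b \<in> grade sG \<sigma> N n"
  shows "W.regular_part (\<lambda>k. \<pi> (br (gen a k) (monomial b n)) w) (\<lambda>k. \<pi>R (br (gen a k) (monomial b n)) w)"
proof -
  define z :: "'a affine" where "z = (0, - of_int n / of_nat N * form (grade_proj (- n) a) b)"
  have z: "z \<in> L" "\<pi>R z w = \<pi> z w"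
    by (simp_all add: z_def carrier_central \<pi>R_central \<pi>_central)
  have eq: "br (gen a k) (monomial b n) = gen (bracket a b) (k + - n) + (if k = n - int N then z else 0)" for k
    using gen_series_bracket[OF assms, of a k] by (simp add: z_def)
  have "\<pi> (br (gen a k) (monomial b n)) w =
      \<pi> (gen (bracket a b) (k + - n)) w + (if k = n - int N then \<pi> z w else 0)" for k
    unfolding eq using z by (simp add: \<pi>_add carrier_gen_series)
  moreover have "\<pi>R (br (gen a k) (monomial b n)) w =
      \<pi>R (gen (bracket a b) (k + - n)) w + (if k = n - int N then \<pi> z w else 0)" for k
    unfolding eq using z by (simp add: \<pi>R_add carrier_gen_series)
  ultimately show ?thesis
    using W.regular_part_add[OF W.regular_part_shift[OF \<pi>R_regular[of "bracket a b" w], of "- n"]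
      W.regular_part_self[OF truncated_point[of "n - int N" "\<pi> z w"]]] by simp
qed

text \<open>Used for \<open>T = \<pi> v\<close> and then for \<open>T = \<pi>R v\<close>.\<close>

lemma regular_part_commutator:
  assumes "W.endo T"
  shows "W.regular_part (\<lambda>k. \<pi> (gen a k) (T w) - T (\<pi> (gen a k) w))
    (\<lambda>k. \<pi>R (gen a k) (T w) - T (\<pi>R (gen a k) w))"
  by (rule W.regular_part_diff[OF \<pi>R_regular W.regular_part_endo[OF \<pi>R_regular assms]])

lemma \<pi>R_\<pi>_commutator:
  assumes "u \<in> L" "v \<in> L"
  shows "\<pi>R (br u v) w = \<pi>R u (\<pi> v w) - \<pi> v (\<pi>R u w)"
  using assms(1)
proof (induction arbitrary: w rule: carrier_induct)
  case (monomial a m)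
  note a = monomial
  show ?case
    using assms(2)
  proof (induction arbitrary: w rule: carrier_induct)
    case (monomial b n)
    have "W.regular_part (\<lambda>k. \<pi> (br (gen a k) (monomial b n)) w)
        (\<lambda>k. \<pi>R (gen a k) (\<pi> (monomial b n) w) - \<pi> (monomial b n) (\<pi>R (gen a k) w))"
      using regular_part_commutator[OF \<pi>_endo[OF carrier_monomial[OF monomial]]]
      by (simp add: \<pi>_bracket carrier_gen_series carrier_monomial monomial)
    from W.regular_part_unique[OF regular_part_bracket[OF monomial] this]
    show ?case
      unfolding monomial_eq_gen_series[OF a] .
  next
    case (central c)
    show ?case
      using \<pi>R_central_comm[OF carrier_monomial[OF a]] \<pi>R_endo[OF carrier_monomial[OF a]]
      by (simp add: \<pi>_central \<pi>R_0 W.endo_scale)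
  next
    case (add u v)
    then show ?case
      using \<pi>R_endo[OF carrier_monomial[OF a]]
      by (simp add: affine_bracket_add_right \<pi>R_add \<pi>_add carrier_bracket carrier_monomial a W.endo_add)
  qed
next
  case (central c)
  show ?case
    by (simp add: \<pi>R_central \<pi>R_0 W.endo_scale[OF \<pi>_endo[OF assms(2)]] \<pi>_central_comm[OF assms(2)])
next
  case (add u u')
  then show ?case
    by (simp add: affine_bracket_add_left \<pi>R_add carrier_bracket assms(2) W.endo_add[OF \<pi>_endo[OF assms(2)]])
qed

text \<open>Antisymmetry of the bracket moves \<open>\<pi>R\<close> to the second argument, so that
  the series in \<open>u\<close> acts through \<open>\<pi>\<close> and uniqueness can be applied
  once more.\<close>

lemma \<pi>_\<pi>R_commutator:
  assumes "u \<in> L" "v \<in> L"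
  shows "\<pi>R (br u v) w = \<pi> u (\<pi>R v w) - \<pi>R v (\<pi> u w)"
proof -
  have "\<pi>R (br u v) w + \<pi>R (br v u) w = \<pi>R (br u v + br v u) w"
    using assms by (simp add: \<pi>R_add carrier_bracket)
  also have "\<dots> = 0"
    using affine_bracket_antisym[OF assms] by (simp add: \<pi>R_0)
  finally show ?thesis
    using \<pi>R_\<pi>_commutator[OF assms(2,1), of w] by (simp add: algebra_simps)
qed

lemma truncated_\<pi>R_bracket:
  assumes "b \<in> grade sG \<sigma> N n"
  shows "W.truncated (\<lambda>k. \<pi>R (br (gen a k) (monomial b n)) w)"
  using regular_part_bracket[OF assms] by (simp add: W.regular_part_def)

text \<open>With \<open>T = \<pi>R v\<close> the commutator series is
  \<open>\<pi>R [a(x), v] w\<close>. It is already truncated, hence its own regular part.\<close>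

lemma \<pi>R_\<pi>R_commutator:
  assumes "u \<in> L" "v \<in> L"
  shows "\<pi>R (br u v) w = \<pi>R u (\<pi>R v w) - \<pi>R v (\<pi>R u w)"
  using assms(1)
proof (induction arbitrary: w rule: carrier_induct)
  case (monomial a m)
  note a = monomial
  show ?case
    using assms(2)
  proof (induction arbitrary: w rule: carrier_induct)
    case (monomial b n)
    have "W.regular_part (\<lambda>k. \<pi>R (br (gen a k) (monomial b n)) w)
        (\<lambda>k. \<pi>R (gen a k) (\<pi>R (monomial b n) w) - \<pi>R (monomial b n) (\<pi>R (gen a k) w))"
      using regular_part_commutator[OF \<pi>R_endo[OF carrier_monomial[OF monomial]]]
      by (simp add: \<pi>_\<pi>R_commutator carrier_gen_series carrier_monomial monomial)
    from W.regular_part_unique[OF W.regular_part_self[OF truncated_\<pi>R_bracket[OF monomial]] this]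
    show ?case
      unfolding monomial_eq_gen_series[OF a] .
  next
    case (central c)
    show ?case
      using \<pi>R_central_comm[OF carrier_monomial[OF a]] \<pi>R_endo[OF carrier_monomial[OF a]]
      by (simp add: \<pi>R_central \<pi>R_0 W.endo_scale)
  next
    case (add u v)
    then show ?case
      using \<pi>R_endo[OF carrier_monomial[OF a]]
      by (simp add: affine_bracket_add_right \<pi>R_add carrier_bracket carrier_monomial a W.endo_add)
  qed
next
  case (central c)
  show ?case
    by (simp add: \<pi>R_central \<pi>R_0 W.endo_scale[OF \<pi>R_endo[OF assms(2)]] \<pi>R_central_comm[OF assms(2)])
next
  case (add u u')
  then show ?case
    by (simp add: affine_bracket_add_left \<pi>R_add carrier_bracket assms(2) W.endo_add[OF \<pi>R_endo[OF assms(2)]])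
qed

lemma lie_rep_\<pi>R: "lie_rep L sL br sW \<pi>R"
  by (simp add: lie_rep_def \<pi>R_linear \<pi>R_\<pi>R_commutator)

text \<open>\<open>\<pi>R u\<close> has the same commutator with \<open>\<pi> v\<close> and with
  \<open>\<pi>R v\<close>, hence commutes with their difference.\<close>

lemma \<pi>R_\<pi>E_commute: "u \<in> L \<Longrightarrow> v \<in> L \<Longrightarrow> \<pi>R u (\<pi>E v w) = \<pi>E v (\<pi>R u w)"
  using \<pi>R_\<pi>_commutator[of u v w] \<pi>R_\<pi>R_commutator[of u v w]
  by (simp add: \<pi>E_eq W.endo_diff[OF \<pi>R_endo] algebra_simps)

lemma \<pi>E_\<pi>E_commutator:
  assumes "u \<in> L" "v \<in> L"
  shows "\<pi>E (br u v) w = \<pi>E u (\<pi>E v w) - \<pi>E v (\<pi>E u w)"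
proof -
  \<comment> \<open>Expansion of \<open>\<pi>E = \<pi> - \<pi>R\<close> into four commutators: the
    first is \<open>\<pi> [u, v]\<close>, the other three are \<open>\<pi>R [u, v]\<close> with
    signs -, -, +.\<close>
  have "\<pi>E u (\<pi>E v w) - \<pi>E v (\<pi>E u w) =
      (\<pi> u (\<pi> v w) - \<pi> v (\<pi> u w)) - (\<pi> u (\<pi>R v w) - \<pi>R v (\<pi> u w))
      - (\<pi>R u (\<pi> v w) - \<pi> v (\<pi>R u w)) + (\<pi>R u (\<pi>R v w) - \<pi>R v (\<pi>R u w))"
    using assms by (simp add: \<pi>E_eq W.endo_diff[OF \<pi>R_endo] W.endo_diff[OF \<pi>_endo] algebra_simps)
  also have "\<dots> = \<pi>E (br u v) w"
    using assms by (simp add: \<pi>E_eq carrier_bracket \<pi>_bracket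
        flip: \<pi>_\<pi>R_commutator \<pi>R_\<pi>_commutator \<pi>R_\<pi>R_commutator)
  finally show ?thesis ..
qed

lemma lie_rep_\<pi>E: "lie_rep L sL br sW \<pi>E"
  by (simp add: lie_rep_def \<pi>E_linear \<pi>E_\<pi>E_commutator)

section \<open>The representation of the direct sum\<close>

lemma lie_rep_sum:
  "lie_rep (L \<times> L) (dsum_scale sL) (dsum_bracket br) sW (\<lambda>(u, v) w. \<pi>R u w + \<pi>E v w)"
  unfolding lie_rep_def linear_to_End_def
proof (intro conjI ballI allI)
  fix x assume "x \<in> L \<times> L"
  then show "W.endo ((\<lambda>(u, v) w. \<pi>R u w + \<pi>E v w) x)"
    by (auto intro: W.endo_plus \<pi>R_endo \<pi>E_endo)
next
  fix x y w assume "x \<in> L \<times> L" "y \<in> L \<times> L"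
  then show "(\<lambda>(u, v) w. \<pi>R u w + \<pi>E v w) (x + y) w =
      (\<lambda>(u, v) w. \<pi>R u w + \<pi>E v w) x w + (\<lambda>(u, v) w. \<pi>R u w + \<pi>E v w) y w"
    by (simp add: mem_Times_iff case_prod_beta \<pi>R_add \<pi>E_add)
next
  fix c x w assume "x \<in> L \<times> L"
  then show "(\<lambda>(u, v) w. \<pi>R u w + \<pi>E v w) (dsum_scale sL c x) w = sW c ((\<lambda>(u, v) w. \<pi>R u w + \<pi>E v w) x w)"
    by (auto simp: dsum_scale_def \<pi>R_scale \<pi>E_scale W.scale_right_distrib)
next
  fix x y w assume "x \<in> L \<times> L" "y \<in> L \<times> L"
  then obtain u v u' v' where "x = (u, v)" "y = (u', v')" "u \<in> L" "v \<in> L" "u' \<in> L" "v' \<in> L"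
    by auto
  then show "(\<lambda>(u, v) w. \<pi>R u w + \<pi>E v w) (dsum_bracket br x y) w =
      (\<lambda>(u, v) w. \<pi>R u w + \<pi>E v w) x ((\<lambda>(u, v) w. \<pi>R u w + \<pi>E v w) y w) -
      (\<lambda>(u, v) w. \<pi>R u w + \<pi>E v w) y ((\<lambda>(u, v) w. \<pi>R u w + \<pi>E v w) x w)"
    by (simp add: dsum_bracket_def \<pi>R_\<pi>R_commutator \<pi>E_\<pi>E_commutator W.endo_add[OF \<pi>R_endo]
        W.endo_add[OF \<pi>E_endo] \<pi>R_\<pi>E_commute)
qed

text \<open>Diagonal pairs \<open>(x, x)\<close> act as \<open>\<pi> x\<close>, so a subspace
  invariant under the direct sum is invariant under \<open>\<pi>\<close>.\<close>

lemma irreducible_sum: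
  assumes "irreducible_rep L sW \<pi>"
  shows "irreducible_rep (L \<times> L) sW (\<lambda>(u, v) w. \<pi>R u w + \<pi>E v w)"
  unfolding irreducible_rep_def
proof (intro conjI allI impI)
  show "\<exists>w::'b. w \<noteq> 0"
    using assms by (simp add: irreducible_rep_def)
next
  fix U assume U: "module.subspace sW U \<and> (\<forall>x\<in>L \<times> L. \<forall>u\<in>U. (\<lambda>(u, v) w. \<pi>R u w + \<pi>E v w) x u \<in> U)"
  have "\<pi> x u \<in> U" if "x \<in> L" "u \<in> U" for x u
  proof -
    have "\<pi>R x u + \<pi>E x u \<in> U"
      using U that by fastforce
    then show ?thesis
      using that by (simp add: \<pi>E_eq)
  qed
  then show "U = {0} \<or> U = UNIV"
    using U assms unfolding irreducible_rep_def by blast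
qed

section \<open>Categories and integrability of the two parts\<close>

lemma category_R_\<pi>R: "category_R sG \<sigma> N sW \<pi>R"
  using \<pi>R_regular by (auto simp: category_R_def calE_def \<pi>R_endo carrier_gen_series
      W.regular_part_def W.truncated_def)

text \<open>The polynomial witnessing category \<open>\<C>\<close> for \<open>\<pi>\<close> serves
  for all \<open>a\<close> at once, by \<open>poly_act_regular_part\<close>.\<close>

lemma category_E_\<pi>E: "category_E sG \<sigma> N sW \<pi>E"
proof -
  obtain p where p: "p \<noteq> 0" "\<And>a. poly_mult_series N sW p (\<lambda>k. \<pi> (gen a k)) \<in> calE sW"
    using category_C unfolding category_C_def by blast
  have "poly_mult_series N sW p (\<lambda>k. \<pi>E (gen a k)) k w = 0" for a k w
    using W.poly_act_regular_part[OF \<pi>R_regular W.truncated_if_calE[OF p(2)], of a w k]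
    by (simp add: W.poly_mult_series_eq \<pi>E_eq carrier_gen_series)
  then show ?thesis
    using p(1) unfolding category_E_def by blast
qed

lemma integrable:
  assumes "integrable_rep sG bracket \<sigma> N H0 \<pi>"
  shows "integrable_rep sG bracket \<sigma> N H0 \<pi>R \<and> integrable_rep sG bracket \<sigma> N H0 \<pi>E"
proof -
  have "W.locally_nilpotent (\<pi>R (monomial a (n * int N + i))) \<and>
      W.locally_nilpotent (\<pi>E (monomial a (n * int N + i)))"
    if i: "i \<in> {0..<int N}" and \<alpha>: "functional_on sG H0 \<alpha>" "\<exists>h\<in>H0. \<alpha> h \<noteq> 0"
      and a: "a \<in> grade sG \<sigma> N i" "a \<in> weight_space sG bracket H0 \<alpha>" for i \<alpha> a n
  proof -
    obtain h where h: "bracket h a = sG (\<alpha> h) a" "\<alpha> h \<noteq> 0"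
      using \<alpha>(2) a(2) by (auto simp: weight_space_def)
    \<comment> \<open>Invariance makes \<open>a\<close> isotropic, since
      \<open>form [h, a] a = form h [a, a] = 0\<close>; this removes the central term from brackets
      of the coefficients of \<open>a(x)\<close>.\<close>
    have "\<alpha> h * form a a = form (bracket h a) a"
      by (simp add: h form_scale_left)
    also have "\<dots> = 0"
      by (simp add: form_invariant bracket_self)
    finally have form_a: "form a a = 0"
      using h by simp
    have "br (gen a k) (gen a l) = 0" for k l
      by (simp add: gen_series_eq grade_proj_of_grade[OF a(1)] affine_bracket_monomial bracket_self
          form_a flip: zero_prod_def)
    then have comm: "\<pi> (gen a k) (\<pi> (gen a l) w) = \<pi> (gen a l) (\<pi> (gen a k) w)"
      and commR: "\<pi>R (gen a k) (\<pi> (gen a l) w) = \<pi> (gen a l) (\<pi>R (gen a k) w)" for k l w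
      using \<pi>_bracket[of "gen a k" "gen a l" w] \<pi>R_\<pi>_commutator[of "gen a k" "gen a l" w]
      by (simp_all add: carrier_gen_series \<pi>_0 \<pi>R_0)
    \<comment> \<open>Coefficients at indices of the wrong residue class are 0; integrability of
      \<open>\<pi>\<close> covers the others.\<close>
    have nil: "W.locally_nilpotent (\<pi> (gen a k))" for k
    proof (cases "(i - (- k - int N)) mod int N = 0")
      case True
      then have "(- k - int N) mod int N = i"
        using i by (metis atLeastLessThan_iff mod_eq_dvd_iff mod_pos_pos_trivial mod_0_imp_dvd)
      then obtain n' where n': "- k - int N = n' * int N + i"
        by (metis div_mult_mod_eq)
      have "gen a k = monomial a (n' * int N + i)"
        using True by (simp add: gen_series_eq grade_proj_of_grade[OF a(1)] n')
      then show ?thesis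
        using assms i \<alpha> a unfolding integrable_rep_def W.locally_nilpotent_def by auto
    next
      case False
      then have "gen a k = 0"
        by (simp add: gen_series_eq grade_proj_of_grade[OF a(1)])
      then show ?thesis
        by (auto simp: W.locally_nilpotent_def \<pi>_0 intro: exI[of _ 1])
    qed
    define k where "k = - (n * int N + i) - int N"
    have "a \<in> grade sG \<sigma> N (n * int N + i)"
      using a(1) grade_mod[of "n * int N + i"] grade_mod[of i] by simp
    then have mon: "monomial a (n * int N + i) = gen a k"
      by (simp add: k_def monomial_eq_gen_series)
    have R: "W.endo (\<pi>R (gen a k))" "W.locally_nilpotent (\<pi>R (gen a k))"
      using W.locally_nilpotent_span[of "\<lambda>k. \<pi> (gen a k)" "\<pi>R (gen a k)"] nil comm commR
        psi_R_span[of a k] by (simp_all add: \<pi>_endo \<pi>R_endo carrier_gen_series \<pi>R_gen)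
    \<comment> \<open>\<open>\<pi>E\<close> is treated as \<open>\<pi> + (-1) \<pi>R\<close>, a sum
      of two commuting locally nilpotent operators.\<close>
    have "W.locally_nilpotent (\<lambda>w. \<pi> (gen a k) w + sW (- 1) (\<pi>R (gen a k) w))"
    proof (rule W.locally_nilpotent_add)
      show "W.endo (\<pi> (gen a k))"
        by (simp add: \<pi>_endo carrier_gen_series)
      show "W.endo (\<lambda>w. sW (- 1) (\<pi>R (gen a k) w))"
        using R(1) by (simp add: W.endo_iff)
      show "W.locally_nilpotent (\<lambda>w. sW (- 1) (\<pi>R (gen a k) w))"
        using R by (rule W.locally_nilpotent_scale)
      show "\<pi> (gen a k) (sW (- 1) (\<pi>R (gen a k) w)) = sW (- 1) (\<pi>R (gen a k) (\<pi> (gen a k) w))" for w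
        by (simp only: commR W.endo_scale[OF \<pi>_endo[OF carrier_gen_series]])
    qed (rule nil)
    moreover have "\<pi>E (gen a k) = (\<lambda>w. \<pi> (gen a k) w + sW (- 1) (\<pi>R (gen a k) w))"
      by (rule ext) (simp add: \<pi>E_eq carrier_gen_series)
    ultimately show ?thesis
      using R by (simp add: mon)
  qed
  then show ?thesis
    unfolding integrable_rep_def W.locally_nilpotent_def by blast
qed

end

theorem theorem5p9:
  fixes sG :: "complex \<Rightarrow> 'g::ab_group_add \<Rightarrow> 'g"
    and bracket :: "'g \<Rightarrow> 'g \<Rightarrow> 'g"
    and form :: "'g \<Rightarrow> 'g \<Rightarrow> complex"
    and \<sigma> :: "'g \<Rightarrow> 'g"
    and N :: nat
    and H0 :: "'g set"
    and sW :: "complex \<Rightarrow> 'w::ab_group_add \<Rightarrow> 'w"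
    and \<pi> :: "'g affine \<Rightarrow> 'w \<Rightarrow> 'w"
  defines "L \<equiv> affine_carrier sG \<sigma> N"
    and "sL \<equiv> affine_scale sG"
    and "br \<equiv> affine_bracket bracket form N"
  assumes "twisted_affine_data sG bracket form \<sigma> N"
    and "cartan_subalgebra sG bracket (grade sG \<sigma> N 0) H0"
    and "vector_space sW"
    and "lie_rep L sL br sW \<pi>"
    and "integrable_rep sG bracket \<sigma> N H0 \<pi>"
    and "category_C sG \<sigma> N sW \<pi>"
  shows "(\<exists>\<pi>R. is_pi_R sG \<sigma> N sW \<pi> \<pi>R) \<and> (\<exists>\<pi>E. is_pi_E sG \<sigma> N sW \<pi> \<pi>E) \<and>
    (\<forall>\<pi>R \<pi>E. is_pi_R sG \<sigma> N sW \<pi> \<pi>R \<and> is_pi_E sG \<sigma> N sW \<pi> \<pi>E \<longrightarrow>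
      (\<forall>u\<in>L. \<forall>w. \<pi> u w = \<pi>R u w + \<pi>E u w) \<and>
      lie_rep (L \<times> L) (dsum_scale sL) (dsum_bracket br) sW (\<lambda>(u, v) w. \<pi>R u w + \<pi>E v w) \<and>
      (irreducible_rep L sW \<pi> \<longrightarrow>
        irreducible_rep (L \<times> L) sW (\<lambda>(u, v) w. \<pi>R u w + \<pi>E v w)) \<and>
      (lie_rep L sL br sW \<pi>R \<and> category_R sG \<sigma> N sW \<pi>R \<and>
        integrable_rep sG bracket \<sigma> N H0 \<pi>R) \<and>
      (lie_rep L sL br sW \<pi>E \<and> category_E sG \<sigma> N sW \<pi>E \<and>
        integrable_rep sG bracket \<sigma> N H0 \<pi>E))"
proof -
  interpret A: twisted_affine_data sG bracket form \<sigma> N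
    by fact
  interpret C: category_C_rep sG bracket form \<sigma> N sW \<pi>
    using assms A.N_pos
    by (simp add: category_C_rep_def category_C_rep_axioms_def series_space_def
        series_space_axioms_def L_def sL_def br_def)
  \<comment> \<open>The constructed maps settle existence; the remaining claims are proved for every
    admissible pair.\<close>
  have split: "split_rep sG bracket form \<sigma> N sW \<pi> \<pi>R \<pi>E"
    if "is_pi_R sG \<sigma> N sW \<pi> \<pi>R" "is_pi_E sG \<sigma> N sW \<pi> \<pi>E" for \<pi>R \<pi>E
    using that C.category_C_rep_axioms by (simp add: split_rep_def split_rep_axioms_def)
  show ?thesis
    unfolding L_def sL_def br_def
  proof (intro conjI allI impI)
    show "\<exists>\<pi>R. is_pi_R sG \<sigma> N sW \<pi> \<pi>R" "\<exists>\<pi>E. is_pi_E sG \<sigma> N sW \<pi> \<pi>E"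
      using C.is_pi_R_pi_R C.ex_pi_E by blast+
  next
    fix \<pi>R \<pi>E assume "is_pi_R sG \<sigma> N sW \<pi> \<pi>R \<and> is_pi_E sG \<sigma> N sW \<pi> \<pi>E"
    then interpret S: split_rep sG bracket form \<sigma> N sW \<pi> \<pi>R \<pi>E
      using split by blast
    show "\<forall>u\<in>A.L. \<forall>w. \<pi> u w = \<pi>R u w + \<pi>E u w"
      by (simp add: S.\<pi>E_eq)
    show "irreducible_rep (A.L \<times> A.L) sW (\<lambda>(u, v) w. \<pi>R u w + \<pi>E v w)"
      if "irreducible_rep A.L sW \<pi>"
      using that by (rule S.irreducible_sum)
    show "integrable_rep sG bracket \<sigma> N H0 \<pi>R" "integrable_rep sG bracket \<sigma> N H0 \<pi>E"
      using S.integrable[OF assms(8)] by blast+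
    show "category_R sG \<sigma> N sW \<pi>R" "category_E sG \<sigma> N sW \<pi>E"
      by (rule S.category_R_\<pi>R S.category_E_\<pi>E)+
    show "lie_rep (A.L \<times> A.L) (dsum_scale A.sL) (dsum_bracket A.br) sW (\<lambda>(u, v) w. \<pi>R u w + \<pi>E v w)"
      "lie_rep A.L A.sL A.br sW \<pi>R" "lie_rep A.L A.sL A.br sW \<pi>E"
      by (rule S.lie_rep_sum S.lie_rep_\<pi>R S.lie_rep_\<pi>E)+
  qed
qed

end
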